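(* Let $\Omega\subset\mathbb{R}^2$ be a region with smooth boundary which is homeomorphic to a disk with $k$ holes. If a collection of paths $\{\gamma_1,\dots,\gamma_n\}$ slits $\overline\Omega$, then $k/2\le n\le k$.
   Context: A region homeomorphic to a disk with $k$ holes and with smooth ($C^\infty$) boundary has boundary consisting of an outer component $\Sigma_0$ and $k$ interior components $\Sigma_1,\dots,\Sigma_k$, where $\Sigma_i$ is the boundary of the $i$-th hole. A path in $X$ is a piecewise smooth mapping $\gamma:[0,1]\to X$. A set $\mathcal N$ slits $\overline\Omega$ if it is the union of a collection of piecewise smooth, immersed lines such that: (1) each line starts and finishes at the boundary $\partial\Omega$ and leaves the boundary transversally; (2) internal intersections between lines are transversal; (3) the complement $\Omega\setminus\mathcal N$ is connected; (4) an odd number of the lines leaves each interior boundary component $\Sigma_1,\dots,\Sigma_k$. A collection of paths slits $\overline\Omega$ if the union of the images of the paths slits $\overline\Omega$, the images of the paths being the lines in the preceding definition. *)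

theory Defs
  imports "HOL-Analysis.Analysis"
begin

section \<open>Piecewise smooth immersed curves\<close>

text \<open>
  \<open>C\<^sup>\<infinity>\<close> on an interval \<open>I\<close> (one-sided at end points belonging to \<open>I\<close>): \<open>d n\<close> is the
  \<open>n\<close>-th derivative of \<open>c\<close>.
\<close>

definition smooth_on :: "(real \<Rightarrow> 'a::real_normed_vector) \<Rightarrow> real set \<Rightarrow> bool" where
  "smooth_on c I \<longleftrightarrow>
     (\<exists>d :: nat \<Rightarrow> real \<Rightarrow> 'a. d 0 = c \<and>
        (\<forall>n. \<forall>t\<in>I. (d n has_vector_derivative d (Suc n) t) (at t within I)))"

definition piecewise_smooth :: "(real \<Rightarrow> 'a::real_normed_vector) \<Rightarrow> bool" where
  "piecewise_smooth c \<longleftrightarrow>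
     (\<exists>(x :: nat \<Rightarrow> real) m. x 0 = 0 \<and> x m = 1 \<and>
        (\<forall>i<m. x i < x (Suc i) \<and> smooth_on c {x i..x (Suc i)}))"

definition path_into :: "(real \<Rightarrow> 'a::real_normed_vector) \<Rightarrow> 'a set \<Rightarrow> bool" where
  "path_into c X \<longleftrightarrow> piecewise_smooth c \<and> path_image c \<subseteq> X"

text \<open>
  The one-sided velocities of \<open>c : [0,1] \<rightarrow> X\<close> at \<open>t\<close>. For a piecewise smooth curve there is
  a single one except at the finitely many corners, where there are two.
\<close>

definition velocities :: "(real \<Rightarrow> 'a::real_normed_vector) \<Rightarrow> real \<Rightarrow> 'a set" where
  "velocities c t =
     {v. (t < 1 \<and> (c has_vector_derivative v) (at t within {t..1})) \<or>
         (0 < t \<and> (c has_vector_derivative v) (at t within {0..t}))}"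

definition immersed :: "(real \<Rightarrow> 'a::real_normed_vector) \<Rightarrow> bool" where
  "immersed c \<longleftrightarrow> (\<forall>t\<in>{0..1}. 0 \<notin> velocities c t)"


section \<open>Planar regions with smooth boundary\<close>

text \<open>
  Near each boundary point, after a rotation or reflection \<open>f\<close> of the coordinate axes,
  the set is the part of the plane above the graph of a \<open>C\<^sup>\<infinity>\<close> function.
\<close>

definition smooth_boundary :: "(real^2) set \<Rightarrow> bool" where
  "smooth_boundary \<Omega> \<longleftrightarrow>
     (\<forall>p\<in>frontier \<Omega>. \<exists>r>0. \<exists>f :: real^2 \<Rightarrow> real^2. \<exists>\<phi> :: real \<Rightarrow> real.
        orthogonal_transformation f \<and> smooth_on \<phi> UNIV \<and>
        \<Omega> \<inter> ball p r = {x \<in> ball p r. \<phi> (f x $ 1) < f x $ 2})"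

definition disk_with_holes :: "nat \<Rightarrow> (real^2) set \<Rightarrow> bool" where
  "disk_with_holes k D \<longleftrightarrow>
     (\<exists>(c :: nat \<Rightarrow> real^2) r.
        (\<forall>i<k. 0 < r i \<and> cball (c i) (r i) \<subseteq> ball 0 1) \<and>
        (\<forall>i<k. \<forall>j<k. i \<noteq> j \<longrightarrow> disjnt (cball (c i) (r i)) (cball (c j) (r j))) \<and>
        D = cball 0 1 - (\<Union>i<k. ball (c i) (r i)))"

text \<open>
  The homeomorphism is one of bordered surfaces, i.e. it is required of \<open>closure \<Omega>\<close>. If only
  the open set \<open>\<Omega>\<close> were required to be homeomorphic to an open disk with holes, then the
  plane minus \<open>k\<close> closed disks would qualify, although it has no outer boundary component.
\<close>

definition smooth_region_with_holes :: "nat \<Rightarrow> (real^2) set \<Rightarrow> bool" where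
  "smooth_region_with_holes k \<Omega> \<longleftrightarrow>
     open \<Omega> \<and> connected \<Omega> \<and> smooth_boundary \<Omega> \<and>
     (\<exists>D. disk_with_holes k D \<and> closure \<Omega> homeomorphic D)"

definition holes :: "(real^2) set \<Rightarrow> (real^2) set set" where
  "holes \<Omega> = {H \<in> components (- closure \<Omega>). bounded H}"

definition interior_boundary_components :: "(real^2) set \<Rightarrow> (real^2) set set" where
  "interior_boundary_components \<Omega> = frontier ` holes \<Omega>"


section \<open>Slitting\<close>

text \<open>Vectors tangent to \<open>S\<close> at \<open>p\<close>: velocities at \<open>p\<close> of smooth curves running in \<open>S\<close>.\<close>

definition tangent_vector :: "'a::real_normed_vector set \<Rightarrow> 'a \<Rightarrow> 'a \<Rightarrow> bool" where
  "tangent_vector S p v \<longleftrightarrow>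
     (\<exists>c. \<exists>e>0. smooth_on c {-e..e} \<and> c ` {-e..e} \<subseteq> S \<and> c 0 = p \<and>
        (c has_vector_derivative v) (at 0))"

definition joins_boundary_transversally ::
    "(real^2) set \<Rightarrow> (real \<Rightarrow> real^2) \<Rightarrow> bool" where
  "joins_boundary_transversally \<Omega> c \<longleftrightarrow>
     (\<forall>t\<in>{0, 1}. c t \<in> frontier \<Omega> \<and>
        (\<forall>v\<in>velocities c t. \<not> tangent_vector (frontier \<Omega>) (c t) v))"

text \<open>
  Intersections at points of the open set \<open>\<Omega>\<close>; the case \<open>i = j\<close>, \<open>s \<noteq> t\<close> covers the
  self-intersections of a line. At a corner both one-sided velocities must be transversal
  to the other line.
\<close>

definition internal_intersections_transversal ::
    "(real^2) set \<Rightarrow> nat \<Rightarrow> (nat \<Rightarrow> real \<Rightarrow> real^2) \<Rightarrow> bool" where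
  "internal_intersections_transversal \<Omega> n \<gamma> \<longleftrightarrow>
     (\<forall>i\<in>{1..n}. \<forall>j\<in>{1..n}. \<forall>s\<in>{0..1}. \<forall>t\<in>{0..1}.
        (i, s) \<noteq> (j, t) \<and> \<gamma> i s = \<gamma> j t \<and> \<gamma> i s \<in> \<Omega> \<longrightarrow>
        (\<forall>u\<in>velocities (\<gamma> i) s. \<forall>v\<in>velocities (\<gamma> j) t. span {u, v} = UNIV))"

definition paths_slit :: "(real^2) set \<Rightarrow> nat \<Rightarrow> (nat \<Rightarrow> real \<Rightarrow> real^2) \<Rightarrow> bool" where
  "paths_slit \<Omega> n \<gamma> \<longleftrightarrow>
     (\<forall>i\<in>{1..n}. path_into (\<gamma> i) (closure \<Omega>) \<and> immersed (\<gamma> i) \<and>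
        joins_boundary_transversally \<Omega> (\<gamma> i)) \<and>
     internal_intersections_transversal \<Omega> n \<gamma> \<and>
     connected (\<Omega> - (\<Union>i\<in>{1..n}. path_image (\<gamma> i))) \<and>
     (\<forall>\<Sigma>\<in>interior_boundary_components \<Omega>.
        odd (card {i\<in>{1..n}. pathstart (\<gamma> i) \<in> \<Sigma> \<or> pathfinish (\<gamma> i) \<in> \<Sigma>}))"

end

theory Submission
  imports "HOL-Complex_Analysis.Contour_Integration" Defs
begin

text \<open>
  By invariance of domain, the homeomorphism from the closure of \<open>\<Omega>\<close> to a disk with \<open>k\<close> holes
  carries the \<open>k + 1\<close> boundary circles to \<open>k + 1\<close> disjoint Jordan curves that make up the boundary of
  \<open>\<Omega>\<close>. Both bounds count these curves.

  Lower bound (\<open>slit_lower_bound\<close>). The side of a boundary curve away from \<open>\<Omega>\<close> is a component of the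
  complement of the closure, with that curve as its frontier. At most one of the \<open>k + 1\<close> far sides is
  unbounded, so there are at least \<open>k\<close> disjoint interior boundary components. An odd number of slits
  touches each of them, hence at least one does, and \<open>n\<close> slits have only \<open>2 n\<close> ends.

  Upper bound (\<open>slit_upper_bound\<close>). Each slit leaves the boundary transversally, so it enters \<open>\<Omega>\<close> and
  contains a crosscut: a piece with both ends in the boundary and the rest in \<open>\<Omega>\<close>. Consider the
  union of the boundary with crosscuts added one at a time. It starts as a union of \<open>k + 1\<close>
  path-connected compact sets. A crosscut that joins two of them lowers their number by one. A
  crosscut with both ends in the same one, \<open>L\<close>, is impossible: by transversality it meets the earlier
  crosscuts and itself at only countably many parameters, and therefore \<open>L\<close> and the crosscut contain a
  Jordan curve through a point of \<open>\<Omega>\<close> (\<open>Jordan_curve_through_ear\<close>). The curve has points of \<open>\<Omega>\<close> on both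
  sides, even off the negligible set of all slits, and so it would disconnect the complement of the
  slits (\<open>no_Jordan_curve_in_slits\<close>). Since at least one set always remains, \<open>n \<le> k\<close>.
\<close>


section \<open>Jordan curves in the plane\<close>

text \<open>The Jordan curve theorem for curves in the complex numbers, carried over by a linear
  isomorphism and stated symmetrically in the two sides of the curve.\<close>

lemma Jordan_curve_plane:
  fixes c :: "real \<Rightarrow> real^2"
  assumes "simple_path c" "pathfinish c = pathstart c"
  obtains A B where "open A" "connected A" "A \<noteq> {}" "open B" "connected B" "B \<noteq> {}"
    "A \<inter> B = {}" "A \<union> B = - path_image c"
    "frontier A = path_image c" "frontier B = path_image c"
proof -
  obtain f :: "real^2 \<Rightarrow> complex" and g :: "complex \<Rightarrow> real^2"
    where f: "linear f" and g: "linear g" and gf: "\<And>x. g (f x) = x" and fg: "\<And>y. f (g y) = y"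
  proof -
    have "DIM(real^2) = DIM(complex)" by simp
    then show thesis
      using isomorphisms_UNIV_UNIV[where 'M="real^2" and 'N=complex] that by metis
  qed
  have "inj f" "inj g"
    using gf fg by (metis injI)+
  have "simple_path (f \<circ> c)" "pathfinish (f \<circ> c) = pathstart (f \<circ> c)"
    using assms f \<open>inj f\<close> simple_path_linear_image_eq
    by (auto simp: pathfinish_def pathstart_def)
  from Jordan_curve[OF this] obtain P Q where P: "P \<noteq> {}" "open P" "connected P"
    and Q: "Q \<noteq> {}" "open Q" "connected Q" and PQ: "P \<inter> Q = {}" "P \<union> Q = - path_image (f \<circ> c)"
    and fr: "frontier P = path_image (f \<circ> c)" "frontier Q = path_image (f \<circ> c)"
    by metis
  have surjg: "surj g"
    using gf by (metis surjI)
  have img: "g ` path_image (f \<circ> c) = path_image c"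
    by (auto simp: path_image_def image_image gf)
  have op: "open (g ` P)" "open (g ` Q)"
    using open_surjective_linear_image[OF _ g surjg] P Q by auto
  have cn: "connected (g ` P)" "connected (g ` Q)"
    using connected_continuous_image linear_continuous_on[OF g[unfolded linear_conv_bounded_linear]] P Q by blast+
  have disj: "g ` P \<inter> g ` Q = {}"
    using PQ \<open>inj g\<close> by (metis image_Int image_empty)
  have un: "g ` P \<union> g ` Q = - path_image c"
    using PQ \<open>inj g\<close> surjg img
    by (metis bij_def bij_image_Compl_eq image_Un)
  have cl: "path_image c \<subseteq> closure (g ` P)" "path_image c \<subseteq> closure (g ` Q)"
    using closure_linear_image_subset[OF g] fr img
    by (metis Diff_subset frontier_def image_mono subset_trans)+
  have "frontier (g ` P) = path_image c"
  proof
    show "frontier (g ` P) \<subseteq> path_image c"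
    proof -
      have "closure (g ` P) \<inter> g ` Q = {}"
        using open_Int_closure_eq_empty[OF op(2), of "g ` P"] disj by blast
      then show ?thesis
        using un op by (simp add: frontier_def interior_open) blast
    qed
    show "path_image c \<subseteq> frontier (g ` P)"
      using cl op un by (auto simp: frontier_def interior_open)
  qed
  moreover have "frontier (g ` Q) = path_image c"
  proof
    show "frontier (g ` Q) \<subseteq> path_image c"
    proof -
      have "closure (g ` Q) \<inter> g ` P = {}"
        using open_Int_closure_eq_empty[OF op(1), of "g ` Q"] disj by blast
      then show ?thesis
        using un op by (simp add: frontier_def interior_open) blast
    qed
    show "path_image c \<subseteq> frontier (g ` Q)"
      using cl op un by (auto simp: frontier_def interior_open)
  qed
  ultimately show thesis
    using that[of "g ` P" "g ` Q"] op cn P Q disj un by auto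
qed

lemma circle_parametrization:
  fixes a :: "real^2"
  assumes "0 < r"
  obtains c where "simple_path c" "pathfinish c = pathstart c" "path_image c = sphere a r"
proof -
  have "sphere (0::complex) 1 homeomorphic sphere a r"
    using assms by (intro homeomorphic_spheres_gen) auto
  then obtain h k where h: "homeomorphism (sphere (0::complex) 1) (sphere a r) h k"
    by (auto simp: homeomorphic_def)
  let ?c = "h \<circ> circlepath 0 1"
  have "simple_path ?c"
    using h by (intro simple_path_continuous_image)
      (auto simp: simple_path_circlepath homeomorphism_def intro: inj_on_inverseI)
  moreover have "path_image ?c = sphere a r"
    using h by (simp add: path_image_compose homeomorphism_def)
  moreover have "pathfinish ?c = pathstart ?c"
    by (simp add: pathfinish_compose pathstart_compose)
  ultimately show thesis
    using that by blast
qed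


section \<open>Jordan curves through an ear\<close>

lemma excursion_from_closed_set:
  fixes g :: "real \<Rightarrow> 'a::metric_space"
  assumes "path g" "closed L" "g 0 \<in> L" "g 1 \<in> L" "t \<in> {0..1}" "g t \<notin> L"
  obtains a b where "0 \<le> a" "a < t" "t < b" "b \<le> 1" "g a \<in> L" "g b \<in> L"
    "\<And>s. a < s \<Longrightarrow> s < b \<Longrightarrow> g s \<notin> L"
proof -
  have con: "continuous_on {0..1} g"
    using assms(1) by (simp add: path_def)
  have cpt: "compact ({0..t} \<inter> g -` L)" "compact ({t..1} \<inter> g -` L)"
    using assms(5) \<open>closed L\<close>
    by (auto simp: compact_eq_bounded_closed bounded_Int
        intro!: continuous_closed_preimage continuous_on_subset[OF con])
  have ne: "{0..t} \<inter> g -` L \<noteq> {}" "{t..1} \<inter> g -` L \<noteq> {}"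
    using assms by auto
  have "\<exists>a\<in>{0..t} \<inter> g -` L. \<forall>s\<in>{0..t} \<inter> g -` L. s \<le> a"
    using cpt(1) ne(1) by (rule compact_attains_sup)
  moreover have "\<exists>b\<in>{t..1} \<inter> g -` L. \<forall>s\<in>{t..1} \<inter> g -` L. b \<le> s"
    using cpt(2) ne(2) by (rule compact_attains_inf)
  ultimately obtain a b where a: "a \<in> {0..t} \<inter> g -` L" "\<forall>s\<in>{0..t} \<inter> g -` L. s \<le> a"
    and b: "b \<in> {t..1} \<inter> g -` L" "\<forall>s\<in>{t..1} \<inter> g -` L. b \<le> s"
    by blast
  have "a \<noteq> t" "b \<noteq> t"
    using a(1) b(1) assms(6) by auto
  moreover have "g s \<notin> L" if "a < s" "s < b" for s
  proof
    assume "g s \<in> L"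
    show False
    proof (cases "s \<le> t")
      case True
      then have "s \<in> {0..t} \<inter> g -` L" using \<open>g s \<in> L\<close> that a by auto
      then show False using a(2) that by force
    next
      case False
      then have "s \<in> {t..1} \<inter> g -` L" using \<open>g s \<in> L\<close> that b by auto
      then show False using b(2) that by force
    qed
  qed
  ultimately show thesis
    using that[of a b] a b by auto
qed

text \<open>An excursion of the arc away from \<open>L\<close> has two distinct end points, because the arc is
  injective. Closing it up inside the path-connected set \<open>L\<close> gives the Jordan curve.\<close>

lemma Jordan_curve_through_arc:
  fixes L :: "'a::{complete_space,real_normed_vector} set"
  assumes "closed L" "path_connected L" "arc h" "pathstart h \<in> L" "pathfinish h \<in> L"
    and "y \<in> path_image h" "y \<notin> L"
  obtains c where "simple_path c" "pathfinish c = pathstart c"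
    "path_image c \<subseteq> L \<union> path_image h" "y \<in> path_image c"
proof -
  obtain t where t: "t \<in> {0..1}" "y = h t"
    using assms(6) by (auto simp: path_image_def)
  have "path h" "h 0 \<in> L" "h 1 \<in> L" "h t \<notin> L"
    using assms t arc_imp_path by (auto simp: pathstart_def pathfinish_def)
  then obtain a b where ab: "0 \<le> a" "a < t" "t < b" "b \<le> 1" "h a \<in> L" "h b \<in> L"
    and out: "\<And>s. a < s \<Longrightarrow> s < b \<Longrightarrow> h s \<notin> L"
    using excursion_from_closed_set[OF _ \<open>closed L\<close> _ _ t(1)] by blast
  let ?e = "subpath a b h"
  have e: "arc ?e"
    using arc_subpath_arc[OF \<open>arc h\<close>, of a b] ab by auto
  have eim: "path_image ?e = h ` {a..b}"
    using ab by (simp add: path_image_subpath)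
  have "h b \<noteq> h a"
    using arc_distinct_ends[OF e] by (simp add: eq_commute)
  have "\<forall>x\<in>L. \<forall>y\<in>L. x \<noteq> y \<longrightarrow>
      (\<exists>g. arc g \<and> path_image g \<subseteq> L \<and> pathstart g = x \<and> pathfinish g = y)"
    using assms(2) by (simp only: path_connected_arcwise)
  from this[rule_format, OF ab(6,5) \<open>h b \<noteq> h a\<close>] obtain g where g: "arc g" "path_image g \<subseteq> L" "pathstart g = h b" "pathfinish g = h a"
    by blast
  have "path_image ?e \<inter> path_image g \<subseteq> {pathstart ?e, pathstart g}"
  proof
    fix x assume x: "x \<in> path_image ?e \<inter> path_image g"
    then obtain s where "s \<in> {a..b}" "x = h s" "x \<in> L"
      using g eim by auto
    then have "s = a \<or> s = b"
      using out[of s] by force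
    then show "x \<in> {pathstart ?e, pathstart g}"
      using \<open>x = h s\<close> g by auto
  qed
  then have "simple_path (?e +++ g)"
    using e g by (intro simple_path_join_loop) auto
  moreover have "path_image (?e +++ g) = path_image ?e \<union> path_image g"
    using g by (simp add: path_image_join)
  moreover have "path_image ?e \<subseteq> path_image h" "y \<in> path_image ?e"
    using ab t eim by (auto simp: path_image_def)
  ultimately show thesis
    using g by (intro that[of "?e +++ g"]) auto
qed

lemma uncountable_arc_image:
  assumes "arc h"
  shows "uncountable (path_image h)"
proof
  assume "countable (path_image h)"
  then have "countable {0..1::real}"
    using assms unfolding arc_def path_image_def by (intro countable_image_inj_on[of h]) auto
  then show False
    using uncountable_closed_interval[of 0 "1::real"] by linarith
qed

text \<open>The curve may meet \<open>L\<close> and itself, and its two ends may coincide. Both kinds of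
  coincidence are countable, so a short piece of it has distinct ends and contains an arc, which
  is uncountable and hence is not swallowed by the rest of the curve together with \<open>L\<close>.\<close>

lemma Jordan_curve_through_ear:
  fixes L :: "'a::{complete_space,real_normed_vector} set" and a b :: real
  assumes L: "compact L" "path_connected L" and ab: "a < b"
    and g: "continuous_on {a..b} g" "g a \<in> L" "g b \<in> L"
    and cL: "countable {s\<in>{a<..<b}. g s \<in> L}"
    and cg: "countable {s\<in>{a<..<b}. \<exists>t\<in>{a..b}. t \<noteq> s \<and> g t = g s}"
  obtains c s where "simple_path c" "pathfinish c = pathstart c"
    "path_image c \<subseteq> L \<union> g ` {a..b}" "s \<in> {a<..<b}" "g s \<in> path_image c"
proof -
  define S where "S = {s\<in>{a<..<b}. \<exists>t\<in>{a..b}. t \<noteq> s \<and> g t = g s}"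
  have "countable S"
    using cg by (simp add: S_def)
  have "uncountable ({a<..<b} - S)"
    using uncountable_minus_countable[OF _ \<open>countable S\<close>] uncountable_open_interval[of a b] ab
    by simp
  then have "infinite ({a<..<b} - S)"
    by (rule uncountable_infinite)
  then obtain u where u: "u \<in> {a<..<b} - S"
    by (metis finite.emptyI ex_in_conv)
  have "infinite ({a<..<b} - S - {u})"
    using \<open>infinite ({a<..<b} - S)\<close> by (rule Diff_infinite_finite[rotated]) simp
  then obtain v where v: "v \<in> {a<..<b} - S - {u}"
    by (metis finite.emptyI ex_in_conv)
  define p q where "p = min u v" and "q = max u v"
  have pq: "a < p" "p < q" "q < b" "p \<notin> S"
    using u v unfolding p_def q_def by (auto simp: min_def max_def)
  \<comment> \<open>Attaching the rest of the curve to \<open>L\<close> leaves an ear with two distinct ends.\<close>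
  let ?L = "L \<union> g ` {a..p} \<union> g ` {q..b}"
  have cont: "continuous_on {x..y} g" if "a \<le> x" "y \<le> b" for x y
    using g(1) by (rule continuous_on_subset) (use that in auto)
  have "compact (g ` {a..p})" "compact (g ` {q..b})"
    using cont pq by (auto intro!: compact_continuous_image)
  then have clL: "closed ?L"
    using L by (intro compact_imp_closed compact_Un)
  have pc: "path_connected (g ` {a..p})" "path_connected (g ` {q..b})"
    using cont pq by (auto intro!: path_connected_continuous_image)
  have "L \<inter> g ` {a..p} \<noteq> {}" "(L \<union> g ` {a..p}) \<inter> g ` {q..b} \<noteq> {}"
    using g pq by force+
  then have pcL: "path_connected ?L"
    using path_connected_Un[OF path_connected_Un[OF L(2) pc(1)] pc(2)] by blast
  have "g p \<noteq> g q"
  proof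
    assume "g p = g q"
    then have "p \<in> S"
      using pq unfolding S_def by (auto intro!: bexI[of _ q])
    then show False using pq by simp
  qed
  have "path (subpath p q g)"
    unfolding path_def subpath_def
    using pq by (intro continuous_on_compose2[OF cont[of p q]] continuous_intros)
      (auto simp: mult_left_le algebra_simps intro!: affine_ineq mult_left_mono)
  then obtain h where h: "arc h" "path_image h \<subseteq> g ` {p..q}" "pathstart h = g p" "pathfinish h = g q"
    using path_contains_arc[of "subpath p q g" "g p" "g q"] \<open>g p \<noteq> g q\<close> pq
    by (auto simp: path_image_subpath)
  have "g ` {p..q} \<inter> ?L \<subseteq> g ` ({s\<in>{a<..<b}. g s \<in> L} \<union> S \<union> {p, q})"
  proof
    fix x assume x: "x \<in> g ` {p..q} \<inter> ?L"
    then obtain s where s: "p \<le> s" "s \<le> q" "x = g s" by auto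
    show "x \<in> g ` ({s\<in>{a<..<b}. g s \<in> L} \<union> S \<union> {p, q})"
    proof (cases "s = p \<or> s = q")
      case False
      then have "p < s" "s < q" using s by auto
      then have "g s \<in> L \<or> s \<in> S"
      proof (cases "g s \<in> L")
        case False
        then have "g s \<in> g ` ({a..p} \<union> {q..b})"
          using x s by auto
        then obtain r where "r \<in> {a..p} \<union> {q..b}" "g r = g s"
          by (metis imageE)
        moreover from this have "r \<in> {a..b}" "r \<noteq> s"
          using pq \<open>p < s\<close> \<open>s < q\<close> by auto
        ultimately show ?thesis
          using pq \<open>p < s\<close> \<open>s < q\<close> unfolding S_def by auto
      qed simp
      then show ?thesis using s \<open>p < s\<close> \<open>s < q\<close> pq by auto
    qed (use s in auto)
  qed
  moreover have "countable (g ` ({s\<in>{a<..<b}. g s \<in> L} \<union> S \<union> {p, q}))"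
    using cL \<open>countable S\<close> by (intro countable_image countable_Un) auto
  ultimately have "countable (path_image h \<inter> ?L)"
    using h(2) by (meson Int_mono countable_subset order_refl)
  then obtain y where y: "y \<in> path_image h" "y \<notin> ?L"
    using uncountable_arc_image[OF h(1)] by (metis Int_absorb2 subsetI)
  have "pathstart h \<in> ?L" "pathfinish h \<in> ?L"
    using h pq by auto
  then obtain c where c: "simple_path c" "pathfinish c = pathstart c"
      "path_image c \<subseteq> ?L \<union> path_image h" "y \<in> path_image c"
    by (rule Jordan_curve_through_arc[OF clL pcL h(1) _ _ y])
  obtain s where s: "s \<in> {p..q}" "y = g s"
    using y h by blast
  have sub: "?L \<union> path_image h \<subseteq> L \<union> g ` {a..b}"
    using h(2) pq by force
  show thesis
  proof (intro that[of c s])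
    show "s \<in> {a<..<b}" "g s \<in> path_image c"
      using c s pq by auto
    show "path_image c \<subseteq> L \<union> g ` {a..b}"
      using c(3) sub by (rule subset_trans)
  qed (use c in auto)
qed

section \<open>Piecewise smooth curves\<close>

lemma piecewise_smoothE:
  assumes "piecewise_smooth c"
  obtains x m where "x 0 = 0" "x m = (1::real)"
    "\<And>i. i < m \<Longrightarrow> x i < x (Suc i)" "\<And>i. i < m \<Longrightarrow> {x i..x (Suc i)} \<subseteq> {0..1}"
    "{0..1} \<subseteq> (\<Union>i<m. {x i..x (Suc i)})"
    "\<And>i t. i < m \<Longrightarrow> t \<in> {x i..x (Suc i)} \<Longrightarrow>
       \<exists>v. (c has_vector_derivative v) (at t within {x i..x (Suc i)})"
proof -
  obtain x m where x: "x 0 = 0" "x m = 1"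
    and sm: "\<And>i. i < m \<Longrightarrow> x i < x (Suc i) \<and> smooth_on c {x i..x (Suc i)}"
    using assms unfolding piecewise_smooth_def by auto
  have mono: "x i \<le> x j" if "i \<le> j" "j \<le> m" for i j
    using that
  proof (induction j rule: dec_induct)
    case (step n)
    then show ?case
      using sm[of n] by auto
  qed simp
  have "{x i..x (Suc i)} \<subseteq> {0..1}" if "i < m" for i
    using mono[of 0 i] mono[of "Suc i" m] x that by auto
  moreover have "\<exists>v. (c has_vector_derivative v) (at t within {x i..x (Suc i)})"
    if "i < m" "t \<in> {x i..x (Suc i)}" for i t
    using sm[OF that(1)] that(2) unfolding smooth_on_def by metis
  moreover have "{0..1} \<subseteq> (\<Union>i<m. {x i..x (Suc i)})"
  proof
    fix t :: real assume t: "t \<in> {0..1}"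
    have "0 < m"
      using x by (intro gr0I) auto
    show "t \<in> (\<Union>i<m. {x i..x (Suc i)})"
    proof (cases "t = 0")
      case True
      then have "t \<in> {x 0..x (Suc 0)}"
        using x(1) sm[OF \<open>0 < m\<close>] by auto
      then show ?thesis
        using \<open>0 < m\<close> by blast
    next
      case False
      define j where "j = (LEAST j. t \<le> x j)"
      have "t \<le> x m" using x t by simp
      then have j: "t \<le> x j" "j \<le> m"
        unfolding j_def by (rule LeastI, rule Least_le)
      then obtain i where i: "j = Suc i"
        using x t False by (cases j) auto
      then have "x i < t"
        using not_less_Least[of i "\<lambda>j. t \<le> x j"] by (simp add: j_def)
      then show ?thesis
        using i j by (auto intro!: bexI[of _ i])
    qed
  qed
  ultimately show thesis
    using x sm by (intro that[of x m]) blast+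
qed

lemma piecewise_smooth_right_velocity:
  assumes "piecewise_smooth c" "0 \<le> t" "t < 1"
  obtains v where "(c has_vector_derivative v) (at t within {t..1})"
proof -
  obtain x m where x: "x 0 = 0" "x m = (1::real)"
    and less: "\<And>i. i < m \<Longrightarrow> x i < x (Suc i)"
    and sub: "\<And>i. i < m \<Longrightarrow> {x i..x (Suc i)} \<subseteq> {0..1}"
    and cover: "{0..1} \<subseteq> (\<Union>i<m. {x i..x (Suc i)})"
    and D: "\<And>i t. i < m \<Longrightarrow> t \<in> {x i..x (Suc i)} \<Longrightarrow>
       \<exists>v. (c has_vector_derivative v) (at t within {x i..x (Suc i)})"
    using assms(1) by (rule piecewise_smoothE) blast
  define j where "j = (LEAST j. t < x j)"
  have "t < x m" using x assms by simp
  then have j: "t < x j" "j \<le> m"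
    unfolding j_def by (rule LeastI, rule Least_le)
  then obtain i where i: "j = Suc i"
    using x assms by (cases j) auto
  have "x i \<le> t"
    using not_less_Least[of i "\<lambda>j. t < x j"] i by (simp add: j_def)
  then obtain v where "(c has_vector_derivative v) (at t within {x i..x (Suc i)})"
    using D[of i t] i j by auto
  then have "(c has_vector_derivative v) (at t within {t..x (Suc i)})"
    by (rule has_vector_derivative_within_subset) (use \<open>x i \<le> t\<close> in auto)
  moreover have "x (Suc i) \<le> 1"
    using sub[of i] less[of i] i j by auto
  then have "at t within {t..x (Suc i)} = at t within {t..1}"
    using j i by (intro at_within_nhd[of _ "{..<x (Suc i)}"]) auto
  ultimately show thesis
    using that by metis
qed

lemma piecewise_smooth_left_velocity:
  assumes "piecewise_smooth c" "0 < t" "t \<le> 1"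
  obtains v where "(c has_vector_derivative v) (at t within {0..t})"
proof -
  obtain x m where x: "x 0 = 0" "x m = (1::real)"
    and less: "\<And>i. i < m \<Longrightarrow> x i < x (Suc i)"
    and sub: "\<And>i. i < m \<Longrightarrow> {x i..x (Suc i)} \<subseteq> {0..1}"
    and cover: "{0..1} \<subseteq> (\<Union>i<m. {x i..x (Suc i)})"
    and D: "\<And>i t. i < m \<Longrightarrow> t \<in> {x i..x (Suc i)} \<Longrightarrow>
       \<exists>v. (c has_vector_derivative v) (at t within {x i..x (Suc i)})"
    using assms(1) by (rule piecewise_smoothE) blast
  define j where "j = (LEAST j. t \<le> x j)"
  have "t \<le> x m" using x assms by simp
  then have j: "t \<le> x j" "j \<le> m"
    unfolding j_def by (rule LeastI, rule Least_le)
  then obtain i where i: "j = Suc i"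
    using x assms by (cases j) auto
  have "x i < t"
    using not_less_Least[of i "\<lambda>j. t \<le> x j"] i by (simp add: j_def)
  then obtain v where "(c has_vector_derivative v) (at t within {x i..x (Suc i)})"
    using D[of i t] i j by auto
  then have "(c has_vector_derivative v) (at t within {x i..t})"
    by (rule has_vector_derivative_within_subset) (use i j in auto)
  moreover have "0 \<le> x i"
    using sub[of i] less[of i] i j by auto
  then have "at t within {x i..t} = at t within {0..t}"
    using \<open>x i < t\<close> by (intro at_within_nhd[of _ "{x i<..}"]) auto
  ultimately show thesis
    using that by metis
qed

lemma piecewise_smooth_imp_path:
  assumes "piecewise_smooth c"
  shows "path c"
  unfolding path_def continuous_on_eq_continuous_within
proof
  fix t :: real assume t: "t \<in> {0..1}"
  have "continuous (at t within {0..t}) c"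
  proof (cases "t = 0")
    case False
    then have "0 < t" "t \<le> 1" using t by auto
    with assms obtain v where "(c has_vector_derivative v) (at t within {0..t})"
      by (rule piecewise_smooth_left_velocity)
    then show ?thesis
      by (rule has_vector_derivative_continuous)
  qed (use continuous_on_sing[of t c] in \<open>simp add: continuous_on_eq_continuous_within\<close>)
  moreover have "continuous (at t within {t..1}) c"
  proof (cases "t = 1")
    case False
    then have "0 \<le> t" "t < 1" using t by auto
    with assms obtain v where "(c has_vector_derivative v) (at t within {t..1})"
      by (rule piecewise_smooth_right_velocity)
    then show ?thesis
      by (rule has_vector_derivative_continuous)
  qed (use continuous_on_sing[of t c] in \<open>simp add: continuous_on_eq_continuous_within\<close>)
  ultimately have "continuous (at t within {0..t} \<union> {t..1}) c"
    unfolding continuous_within by (rule Lim_Un)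
  moreover have "{0..t} \<union> {t..1} = {0..1}"
    using t by auto
  ultimately show "continuous (at t within {0..1}) c"
    by simp
qed

lemma piecewise_smooth_velocities:
  assumes "piecewise_smooth c" "0 < t" "t < 1"
  obtains u v where "u \<in> velocities c t" "(c has_vector_derivative u) (at t within {0..t})"
    "v \<in> velocities c t" "(c has_vector_derivative v) (at t within {t..1})"
proof -
  obtain u where u: "(c has_vector_derivative u) (at t within {0..t})"
    using piecewise_smooth_left_velocity[OF assms(1,2)] assms(3) by auto
  obtain v where v: "(c has_vector_derivative v) (at t within {t..1})"
    using piecewise_smooth_right_velocity[OF assms(1) _ assms(3)] assms(2) by auto
  show thesis
    using that[of u v] u v assms by (simp add: velocities_def)
qed

lemma negligible_piecewise_smooth_image:
  fixes c :: "real \<Rightarrow> 'a::euclidean_space"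
  assumes "piecewise_smooth c" "2 \<le> DIM('a)"
  shows "negligible (path_image c)"
proof -
  obtain x m where x: "x 0 = 0" "x m = (1::real)"
    and less: "\<And>i. i < m \<Longrightarrow> x i < x (Suc i)"
    and sub: "\<And>i. i < m \<Longrightarrow> {x i..x (Suc i)} \<subseteq> {0..1}"
    and cover: "{0..1} \<subseteq> (\<Union>i<m. {x i..x (Suc i)})"
    and D: "\<And>i t. i < m \<Longrightarrow> t \<in> {x i..x (Suc i)} \<Longrightarrow>
       \<exists>v. (c has_vector_derivative v) (at t within {x i..x (Suc i)})"
    using assms(1) by (rule piecewise_smoothE) blast
  have "negligible (c ` {x i..x (Suc i)})" if "i < m" for i
  proof (rule negligible_differentiable_image_lowdim)
    show "c differentiable_on {x i..x (Suc i)}"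
      unfolding differentiable_on_def using D[OF that] differentiableI_vector by blast
  qed (use assms(2) in simp)
  then have "negligible (\<Union>i<m. c ` {x i..x (Suc i)})"
    by (intro negligible_Union) auto
  then show ?thesis
    by (rule negligible_subset) (use cover in \<open>force simp: path_image_def\<close>)
qed


section \<open>Transversal intersections are countable\<close>

lemma isolated_points_countable:
  fixes E :: "'a::second_countable_topology set"
  assumes "\<And>x. x \<in> E \<Longrightarrow> \<exists>U. open U \<and> U \<inter> E = {x}"
  shows "countable E"
proof -
  obtain B :: "'a set set" where B: "countable B" "topological_basis B"
    using ex_countable_basis by blast
  have "\<exists>b\<in>B. b \<inter> E = {x}" if x: "x \<in> E" for x
  proof -
    obtain U where "open U" "U \<inter> E = {x}"
      using assms x by blast
    then obtain b where "b \<in> B" "x \<in> b" "b \<subseteq> U"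
      using topological_basisE[OF B(2), of U x] by blast
    then show ?thesis
      using \<open>U \<inter> E = {x}\<close> x by blast
  qed
  then obtain b where b: "\<forall>x\<in>E. b x \<in> B \<and> b x \<inter> E = {x}"
    by metis
  have "inj_on b E"
  proof (rule inj_onI)
    fix x y assume "x \<in> E" "y \<in> E" "b x = b y"
    then have "{x} = {y}"
      using b by metis
    then show "x = y" by simp
  qed
  moreover have "b ` E \<subseteq> B"
    using b by blast
  then have "countable (b ` E)"
    using B(1) countable_subset by blast
  ultimately show ?thesis
    using countable_image_inj_on by blast
qed

text \<open>The linear map \<open>(x, y) \<mapsto> x u - y v\<close> is bounded below, so it dominates the errors of the
  two linear approximations.\<close>

lemma one_sided_transversal_isolated:
  fixes c d :: "real \<Rightarrow> real^2"
  assumes c: "(c has_vector_derivative u) (at s within S)"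
    and d: "(d has_vector_derivative v) (at t within T)"
    and uv: "span {u, v} = UNIV" and eq: "c s = d t"
  shows "\<exists>e>0. \<forall>s'\<in>S. \<forall>t'\<in>T. \<bar>s' - s\<bar> < e \<longrightarrow> \<bar>t' - t\<bar> < e \<longrightarrow> c s' = d t' \<longrightarrow>
       s' = s \<and> t' = t"
proof -
  let ?T = "\<lambda>z::real \<times> real. fst z *\<^sub>R u - snd z *\<^sub>R v"
  have "linear ?T"
    by (intro linearI) (auto simp: algebra_simps)
  have "dim {u, v} = 2"
    using uv by (simp add: dim_eq_full[symmetric])
  then have "u \<noteq> v" "independent {u, v}"
    using dim_le_card[of "{u,v}" "{u,v}"] span_superset[of "{u,v}"]
      card_le_dim_spanning[of "{u,v}" "{u,v}"]
    by (auto simp: card_insert_if split: if_splits)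
  have indep: "x = 0 \<and> y = 0" if "x *\<^sub>R u = y *\<^sub>R v" for x y
  proof -
    have sum: "(\<Sum>w\<in>{u, v}. (if w = u then x else - y) *\<^sub>R w) = 0"
      using that \<open>u \<noteq> v\<close> by simp
    show ?thesis
      using independentD[OF \<open>independent {u, v}\<close> _ order_refl sum, of u]
        independentD[OF \<open>independent {u, v}\<close> _ order_refl sum, of v] \<open>u \<noteq> v\<close>
      by simp
  qed
  have "inj ?T"
    using \<open>linear ?T\<close> indep by (auto simp: linear_injective_0 zero_prod_def)
  obtain B where B: "0 < B" "\<And>z. B * norm z \<le> norm (?T z)"
    using linear_inj_bounded_below_pos[OF \<open>linear ?T\<close> \<open>inj ?T\<close>] by blast
  \<comment> \<open>Each of the two errors may use up a quarter of the lower bound, which leaves a half.\<close>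
  have "0 < B / 4" using B by simp
  have approx: "\<exists>e>0. \<forall>y\<in>Y. \<bar>y - x\<bar> < e \<longrightarrow> norm (f y - f x - (y - x) *\<^sub>R w) \<le> B / 4 * \<bar>y - x\<bar>"
    if "(f has_vector_derivative w) (at x within Y)" for f :: "real \<Rightarrow> real^2" and w x Y
    using that \<open>0 < B / 4\<close> unfolding has_vector_derivative_def has_derivative_within_alt real_norm_def
    by blast
  obtain e1 where e1: "0 < e1" "\<And>s'. s' \<in> S \<Longrightarrow> \<bar>s' - s\<bar> < e1 \<Longrightarrow>
      norm (c s' - c s - (s' - s) *\<^sub>R u) \<le> B / 4 * \<bar>s' - s\<bar>"
    using approx[OF c] by blast
  obtain e2 where e2: "0 < e2" "\<And>t'. t' \<in> T \<Longrightarrow> \<bar>t' - t\<bar> < e2 \<Longrightarrow>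
      norm (d t' - d t - (t' - t) *\<^sub>R v) \<le> B / 4 * \<bar>t' - t\<bar>"
    using approx[OF d] by blast
  have iso: "s' = s \<and> t' = t" if h: "s' \<in> S" "t' \<in> T" "\<bar>s' - s\<bar> < min e1 e2"
    "\<bar>t' - t\<bar> < min e1 e2" "c s' = d t'" for s' t'
  proof -
    let ?z = "(s' - s, t' - t)"
    have "B * norm ?z \<le> norm (?T ?z)"
      using B(2) .
    also have "\<dots> = norm ((d t' - d t - (t' - t) *\<^sub>R v) - (c s' - c s - (s' - s) *\<^sub>R u))"
      using h eq by (simp add: algebra_simps)
    also have "\<dots> \<le> B / 4 * \<bar>t' - t\<bar> + B / 4 * \<bar>s' - s\<bar>"
      using e1(2)[of s'] e2(2)[of t'] h by (smt (verit) norm_triangle_ineq4)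
    also have "\<dots> \<le> B / 4 * norm ?z + B / 4 * norm ?z"
      using B(1) norm_fst_le[of "s' - s" "t' - t"] norm_snd_le[of "t' - t" "s' - s"]
      by (intro add_mono mult_left_mono) auto
    finally have "B * norm ?z \<le> B * (norm ?z / 2)"
      by simp
    then have "norm ?z \<le> norm ?z / 2"
      using B(1) by (simp only: mult_le_cancel_left_pos)
    then have "norm ?z \<le> 0"
      by linarith
    then show ?thesis by (auto simp: zero_prod_def)
  qed
  show ?thesis
    using e1(1) e2(1) iso by (intro exI[of _ "min e1 e2"]) auto
qed

text \<open>At a corner the curve has two branches, so four pairs of one-sided branches are to be
  compared.\<close>

lemma transversal_isolated:
  fixes c d :: "real \<Rightarrow> real^2"
  assumes "piecewise_smooth c" "piecewise_smooth d" "0 < s" "s < 1" "0 < t" "t < 1" "c s = d t"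
    and "\<And>u v. u \<in> velocities c s \<Longrightarrow> v \<in> velocities d t \<Longrightarrow> span {u, v} = UNIV"
  shows "\<exists>e>0. \<forall>s'\<in>{0..1}. \<forall>t'\<in>{0..1}. \<bar>s' - s\<bar> < e \<longrightarrow> \<bar>t' - t\<bar> < e \<longrightarrow> c s' = d t' \<longrightarrow>
       s' = s \<and> t' = t"
proof -
  obtain u1 u2 where u: "u1 \<in> velocities c s" "(c has_vector_derivative u1) (at s within {0..s})"
    "u2 \<in> velocities c s" "(c has_vector_derivative u2) (at s within {s..1})"
    using piecewise_smooth_velocities[OF assms(1,3,4)] .
  obtain v1 v2 where v: "v1 \<in> velocities d t" "(d has_vector_derivative v1) (at t within {0..t})"
    "v2 \<in> velocities d t" "(d has_vector_derivative v2) (at t within {t..1})"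
    using piecewise_smooth_velocities[OF assms(2,5,6)] .
  define P where "P S T e \<longleftrightarrow> (\<forall>s'\<in>S. \<forall>t'\<in>T. \<bar>s' - s\<bar> < e \<longrightarrow> \<bar>t' - t\<bar> < e \<longrightarrow> c s' = d t' \<longrightarrow>
       s' = s \<and> t' = t)" for S T e
  have one: "\<exists>e>0. P S T e"
    if "(c has_vector_derivative u) (at s within S)" "(d has_vector_derivative v) (at t within T)"
      "u \<in> velocities c s" "v \<in> velocities d t" for S T u v
    unfolding P_def by (rule one_sided_transversal_isolated[OF that(1,2) assms(8)[OF that(3,4)] assms(7)])
  have "\<exists>e>0. P {0..s} {0..t} e" "\<exists>e>0. P {0..s} {t..1} e"
    "\<exists>e>0. P {s..1} {0..t} e" "\<exists>e>0. P {s..1} {t..1} e"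
    using one u v by blast+
  then obtain e1 e2 e3 e4 where e: "e1 > 0" "P {0..s} {0..t} e1" "e2 > 0" "P {0..s} {t..1} e2"
    "e3 > 0" "P {s..1} {0..t} e3" "e4 > 0" "P {s..1} {t..1} e4"
    by blast
  define e where "e = min (min e1 e2) (min e3 e4)"
  have "0 < e" using e by (simp add: e_def)
  moreover have "s' = s \<and> t' = t" if h: "s' \<in> {0..1}" "t' \<in> {0..1}" "\<bar>s' - s\<bar> < e" "\<bar>t' - t\<bar> < e" "c s' = d t'" for s' t'
  proof -
    have S: "s' \<in> {0..s} \<or> s' \<in> {s..1}" and T: "t' \<in> {0..t} \<or> t' \<in> {t..1}"
      using h by auto
    have small: "\<bar>s' - s\<bar> < x \<and> \<bar>t' - t\<bar> < x" if "x \<in> {e1, e2, e3, e4}" for x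
      using h that by (auto simp: e_def)
    show "s' = s \<and> t' = t"
      using S T
    proof (elim disjE)
      assume "s' \<in> {0..s}" "t' \<in> {0..t}"
      then show ?thesis using e(2) small[of e1] h(5) unfolding P_def by blast
    next
      assume "s' \<in> {0..s}" "t' \<in> {t..1}"
      then show ?thesis using e(4) small[of e2] h(5) unfolding P_def by blast
    next
      assume "s' \<in> {s..1}" "t' \<in> {0..t}"
      then show ?thesis using e(6) small[of e3] h(5) unfolding P_def by blast
    next
      assume "s' \<in> {s..1}" "t' \<in> {t..1}"
      then show ?thesis using e(8) small[of e4] h(5) unfolding P_def by blast
    qed
  qed
  ultimately show ?thesis
    by (intro exI[of _ e]) simp
qed

section \<open>The boundary as a graph\<close>

text \<open>In a boundary chart the region is the strict epigraph, so by continuity its closure is the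
  weak epigraph, and the interior of the closure is the strict epigraph again.\<close>

lemma smooth_boundary_chart:
  assumes "open \<Omega>" "smooth_boundary \<Omega>" "p \<in> frontier \<Omega>"
  obtains r and f :: "real^2 \<Rightarrow> real^2" and \<phi> :: "real \<Rightarrow> real" where "0 < r" "orthogonal_transformation f" "smooth_on \<phi> UNIV"
    "\<And>x. x \<in> ball p r \<Longrightarrow> x \<in> frontier \<Omega> \<longleftrightarrow> \<phi> (f x $ 1) = f x $ 2"
    "\<And>x. x \<in> ball p r \<Longrightarrow> x \<in> interior (closure \<Omega>) \<Longrightarrow> x \<in> \<Omega>"
proof -
  obtain r and f :: "real^2 \<Rightarrow> real^2" and \<phi> :: "real \<Rightarrow> real"
    where r: "0 < r" and f: "orthogonal_transformation f" and sm: "smooth_on \<phi> UNIV"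
    and eq: "\<Omega> \<inter> ball p r = {x \<in> ball p r. \<phi> (f x $ 1) < f x $ 2}"
    using assms(2,3) unfolding smooth_boundary_def by blast
  have linf: "linear f"
    using f by (rule orthogonal_transformation_linear)
  have conf: "continuous_on UNIV f"
    using linf linear_continuous_on linear_linear by blast
  have con\<phi>: "continuous_on UNIV \<phi>"
    using sm unfolding smooth_on_def
    by (metis UNIV_I continuous_on_eq_continuous_within has_vector_derivative_continuous)
  have in\<Omega>: "x \<in> \<Omega> \<longleftrightarrow> \<phi> (f x $ 1) < f x $ 2" if "x \<in> ball p r" for x
    using eq that by blast
  \<comment> \<open>\<open>w\<close> is the vertical direction of the chart.\<close>
  obtain w where w: "f w = axis 2 1"
    using orthogonal_transformation_surj[OF f] by (metis surjD)
  have "norm w = 1"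
    using orthogonal_transformation_norm[OF f, of w] w by simp
  have fw: "f (x + e *\<^sub>R w) $ 1 = f x $ 1" "f (x + e *\<^sub>R w) $ 2 = f x $ 2 + e" for x e
    using w by (simp_all add: linear_add[OF linf] linear_scale[OF linf] axis_def)
  have near: "\<exists>d>0. \<forall>e. \<bar>e\<bar> < d \<longrightarrow> x + e *\<^sub>R w \<in> U" if U: "open U" "x \<in> U" for x U
  proof -
    obtain d where "0 < d" "ball x d \<subseteq> U"
      using U openE by blast
    moreover have "x + e *\<^sub>R w \<in> ball x d" if "\<bar>e\<bar> < d" for e
      using that \<open>norm w = 1\<close> by (simp add: dist_norm)
    ultimately show ?thesis by blast
  qed
  have below: "\<phi> (f x $ 1) \<le> f x $ 2" if x: "x \<in> closure \<Omega>" "x \<in> ball p r" for x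
  proof (rule ccontr)
    assume neg: "\<not> ?thesis"
    let ?U = "ball p r \<inter> {x. f x $ 2 < \<phi> (f x $ 1)}"
    have "open {x. f x $ 2 < \<phi> (f x $ 1)}"
      by (intro open_Collect_less continuous_intros conf continuous_on_compose2[OF con\<phi>]) auto
    then have "open ?U" by blast
    moreover have "?U \<inter> \<Omega> = {}"
      using in\<Omega> by force
    ultimately have "?U \<inter> closure \<Omega> = {}"
      by (simp add: open_Int_closure_eq_empty)
    then show False
      using x neg by auto
  qed
  have graph: "x \<in> closure \<Omega>" if x: "\<phi> (f x $ 1) = f x $ 2" "x \<in> ball p r" for x
    unfolding closure_iff_nhds_not_empty
  proof (intro allI impI)
    fix A U assume U: "U \<subseteq> A" "open U" "x \<in> U"
    have "open (U \<inter> ball p r)" "x \<in> U \<inter> ball p r"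
      using U x by auto
    then obtain d where "d > 0" "\<forall>e. \<bar>e\<bar> < d \<longrightarrow> x + e *\<^sub>R w \<in> U \<inter> ball p r"
      using near by blast
    then have "x + (d / 2) *\<^sub>R w \<in> U \<inter> ball p r"
      by simp
    moreover from this have "x + (d / 2) *\<^sub>R w \<in> \<Omega>"
      using in\<Omega> fw x \<open>d > 0\<close> by simp
    ultimately show "\<Omega> \<inter> A \<noteq> {}"
      using U by blast
  qed
  show thesis
  proof (rule that[OF r f sm])
    fix x assume x: "x \<in> ball p r"
    show "x \<in> frontier \<Omega> \<longleftrightarrow> \<phi> (f x $ 1) = f x $ 2"
      using graph[OF _ x] below[OF _ x] in\<Omega>[OF x] \<open>open \<Omega>\<close>
      by (auto simp: frontier_def interior_open)
    assume int: "x \<in> interior (closure \<Omega>)"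
    then have "x \<in> interior (closure \<Omega>) \<inter> ball p r"
      using x by blast
    then obtain d where d: "d > 0" "\<forall>e. \<bar>e\<bar> < d \<longrightarrow> x + e *\<^sub>R w \<in> interior (closure \<Omega>) \<inter> ball p r"
      using near[of "interior (closure \<Omega>) \<inter> ball p r" x] by blast
    then have "x + (- d / 2) *\<^sub>R w \<in> interior (closure \<Omega>) \<inter> ball p r"
      by (intro d(2)[rule_format]) simp
    then have "\<phi> (f (x + (- d / 2) *\<^sub>R w) $ 1) \<le> f (x + (- d / 2) *\<^sub>R w) $ 2"
      using below interior_subset by blast
    then have "\<phi> (f x $ 1) < f x $ 2"
      unfolding fw using \<open>d > 0\<close> by simp
    then show "x \<in> \<Omega>"
      using in\<Omega>[OF x] by simp
  qed
qed

lemma smooth_boundary_regular_open: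
  assumes "open \<Omega>" "smooth_boundary \<Omega>"
  shows "interior (closure \<Omega>) = \<Omega>"
proof
  show "interior (closure \<Omega>) \<subseteq> \<Omega>"
  proof
    fix x assume x: "x \<in> interior (closure \<Omega>)"
    show "x \<in> \<Omega>"
    proof (rule ccontr)
      assume "x \<notin> \<Omega>"
      then have "x \<in> frontier \<Omega>"
        using x assms(1) interior_subset by (auto simp: frontier_def interior_open)
      from smooth_boundary_chart[OF assms this] show False
        using x \<open>x \<notin> \<Omega>\<close> by (metis centre_in_ball)
    qed
  qed
  show "\<Omega> \<subseteq> interior (closure \<Omega>)"
    using assms(1) closure_subset by (rule interior_maximal[rotated])
qed

text \<open>Tangency is witnessed by two-sided curves, whereas here only a one-sided one is given. In
  a boundary chart its velocity has the form \<open>(a, a \<phi>')\<close>, and the graph itself carries the smooth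
  curve \<open>s \<mapsto> (x + s a, \<phi> (x + s a))\<close> through the same point with that velocity.\<close>

lemma tangent_vector_of_boundary_path:
  assumes "open \<Omega>" "smooth_boundary \<Omega>"
    and c: "\<And>t. t \<in> {0..1} \<Longrightarrow> c t \<in> frontier \<Omega>"
    and v: "(c has_vector_derivative v) (at 0 within {0..1})"
  shows "tangent_vector (frontier \<Omega>) (c 0) v"
proof -
  have "c 0 \<in> frontier \<Omega>" using c by simp
  then obtain r and f :: "real^2 \<Rightarrow> real^2" and \<phi> :: "real \<Rightarrow> real"
    where r: "0 < r" and f: "orthogonal_transformation f" and sm: "smooth_on \<phi> UNIV"
    and graph: "\<And>x. x \<in> ball (c 0) r \<Longrightarrow> x \<in> frontier \<Omega> \<longleftrightarrow> \<phi> (f x $ 1) = f x $ 2"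
    by (rule smooth_boundary_chart[OF assms(1,2)]) blast
  obtain d where d0: "d 0 = \<phi>"
    and dS: "\<And>n t. (d n has_vector_derivative d (Suc n) t) (at t)"
    using sm unfolding smooth_on_def by auto
  have linf: "linear f" and "inj f"
    using f orthogonal_transformation_linear orthogonal_transformation_inj by blast+
  obtain w1 w2 where w1: "f w1 = axis 1 1" and w2: "f w2 = axis 2 1"
    using orthogonal_transformation_surj[OF f] by (metis surjD)
  define x where "x = f (c 0) $ 1"
  define a where "a = f v $ 1"
  have \<phi>x: "\<phi> x = f (c 0) $ 2"
    using graph[of "c 0"] \<open>c 0 \<in> frontier \<Omega>\<close> r by (simp add: x_def)
  have fc: "((\<lambda>t. f (c t)) has_vector_derivative f v) (at 0 within {0..1})"
    using linf v by (simp add: linear_conv_bounded_linear bounded_linear.has_vector_derivative)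
  have coord: "((\<lambda>t. f (c t) $ i) has_vector_derivative f v $ i) (at 0 within {0..1})" for i
    using bounded_linear.has_vector_derivative[OF bounded_linear_vec_nth fc] .
  have dF: "(d n has_field_derivative d (Suc n) t) (at t)" for n t
    using dS by (simp add: has_real_derivative_iff_has_vector_derivative)
  have deriv: "((\<lambda>t. \<phi> (f (c t) $ 1)) has_vector_derivative d 1 x * a) (at 0 within {0..1})"
    using DERIV_chain2[OF dF[of 0] coord[of 1, folded has_real_derivative_iff_has_vector_derivative]]
    by (simp add: d0 a_def x_def has_real_derivative_iff_has_vector_derivative)
  obtain \<delta> where \<delta>: "0 < \<delta>" "\<forall>t\<in>{0..1}. dist t 0 < \<delta> \<longrightarrow> dist (c t) (c 0) < r"
    using has_vector_derivative_continuous[OF v] r unfolding continuous_within_eps_delta by blast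
  have "((\<lambda>t. f (c t) $ 2) has_vector_derivative d 1 x * a) (at 0 within {0..1})"
  proof (rule has_vector_derivative_transform_within[OF deriv \<delta>(1)])
    fix t :: real assume "t \<in> {0..1}" "dist t 0 < \<delta>"
    moreover from this have "dist (c t) (c 0) < r"
      using \<delta>(2) by blast
    ultimately show "\<phi> (f (c t) $ 1) = f (c t) $ 2"
      using graph[of "c t"] c[of t] by (simp add: dist_commute)
  qed simp
  then have slope: "f v $ 2 = d 1 x * a"
    using vector_derivative_unique_within_closed_interval[of 0 1 0] coord[of 2] by simp
  have "f v = f (a *\<^sub>R w1 + (d 1 x * a) *\<^sub>R w2)"
    by (simp add: linear_add[OF linf] linear_scale[OF linf] w1 w2 vec_eq_iff forall_2 axis_def
        slope a_def)
  then have v_eq: "v = a *\<^sub>R w1 + (d 1 x * a) *\<^sub>R w2"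
    using \<open>inj f\<close> by (simp add: inj_eq)
  \<comment> \<open>\<open>C\<close> is the graph of \<open>\<phi>\<close> over the line \<open>x + s a\<close>, written in the original coordinates,
    and \<open>D n\<close> is its \<open>n\<close>-th derivative.\<close>
  define C where "C s = c 0 + (s * a) *\<^sub>R w1 + (\<phi> (x + s * a) - \<phi> x) *\<^sub>R w2" for s
  have fC: "f (C s) $ 1 = x + s * a" "f (C s) $ 2 = \<phi> (x + s * a)" for s
    by (simp_all add: C_def linear_add[OF linf] linear_scale[OF linf] w1 w2 axis_def x_def
        \<phi>x[unfolded x_def])
  define D where "D n = (if n = 0 then C else
    (\<lambda>s. (if n = 1 then a else 0) *\<^sub>R w1 + (a ^ n * d n (x + s * a)) *\<^sub>R w2))" for n
  have deriv_d: "((\<lambda>s. (a ^ n * d n (x + s * a)) *\<^sub>R w2) has_vector_derivative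
      (a ^ Suc n * d (Suc n) (x + s * a)) *\<^sub>R w2) (at s)" for n s
  proof -
    have "((\<lambda>s. x + s * a) has_field_derivative a) (at s)"
      by (auto intro!: derivative_eq_intros)
    from DERIV_cmult[OF DERIV_chain2[OF dF this], of "a ^ n"]
    have "((\<lambda>s. a ^ n * d n (x + s * a)) has_vector_derivative a ^ Suc n * d (Suc n) (x + s * a)) (at s)"
      by (simp add: has_real_derivative_iff_has_vector_derivative mult_ac)
    from bounded_linear.has_vector_derivative[OF bounded_linear_scaleR_left this]
    show ?thesis .
  qed
  have D: "(D n has_vector_derivative D (Suc n) s) (at s)" for n s
  proof (cases "n = 0")
    case True
    have "((\<lambda>s. s * a) has_vector_derivative a) (at s)"
      by (auto intro!: derivative_eq_intros simp: has_real_derivative_iff_has_vector_derivative[symmetric])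
    note lin = bounded_linear.has_vector_derivative[OF bounded_linear_scaleR_left this, of w1]
    have "((\<lambda>s. c 0 - \<phi> x *\<^sub>R w2 + ((s * a) *\<^sub>R w1 + (a ^ 0 * d 0 (x + s * a)) *\<^sub>R w2))
        has_vector_derivative 0 + (a *\<^sub>R w1 + (a ^ Suc 0 * d (Suc 0) (x + s * a)) *\<^sub>R w2)) (at s)"
      by (intro has_vector_derivative_add has_vector_derivative_const lin deriv_d)
    moreover have "C = (\<lambda>s. c 0 - \<phi> x *\<^sub>R w2 +
        ((s * a) *\<^sub>R w1 + (a ^ 0 * d 0 (x + s * a)) *\<^sub>R w2))"
      by (auto simp: C_def d0 algebra_simps)
    ultimately show ?thesis
      using True by (simp add: D_def)
  next
    case False
    have "((\<lambda>s. (if n = 1 then a else 0) *\<^sub>R w1 + (a ^ n * d n (x + s * a)) *\<^sub>R w2)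
        has_vector_derivative 0 + (a ^ Suc n * d (Suc n) (x + s * a)) *\<^sub>R w2) (at s)"
      by (intro has_vector_derivative_add has_vector_derivative_const deriv_d)
    then show ?thesis
      using False by (simp add: D_def)
  qed
  have D0: "D 0 = C" and D1: "D (Suc 0) 0 = v" and C0: "C 0 = c 0"
    by (simp_all add: D_def C_def v_eq mult.commute)
  have CD: "(C has_vector_derivative D (Suc 0) s) (at s)" for s
    using D[of 0 s] D0 by simp
  have "isCont C 0"
    using has_vector_derivative_continuous[OF CD] .
  then obtain e where e: "0 < e" "\<forall>s. dist s 0 < e \<longrightarrow> dist (C s) (C 0) < r"
    using r unfolding continuous_at_eps_delta by blast
  show ?thesis
    unfolding tangent_vector_def
  proof (intro exI conjI)
    show "0 < e / 2" "C 0 = c 0"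
      using e C0 by auto
    show "(C has_vector_derivative v) (at 0)"
      using CD[of 0] D1 by simp
    show "smooth_on C {- (e / 2)..e / 2}"
      unfolding smooth_on_def using D0 D has_vector_derivative_at_within by blast
    show "C ` {- (e / 2)..e / 2} \<subseteq> frontier \<Omega>"
    proof
      fix y assume "y \<in> C ` {- (e / 2)..e / 2}"
      then obtain s where "\<bar>s\<bar> < e" "y = C s"
        using e(1) by force
      then show "y \<in> frontier \<Omega>"
        using graph[of "C s"] e(2) fC C0 by (simp add: dist_commute)
    qed
  qed
qed

section \<open>The boundary curves and the holes of a region\<close>

lemma disk_with_holes_boundary:
  assumes "disk_with_holes k D"
  obtains e :: "nat \<Rightarrow> real \<Rightarrow> real^2"
  where "\<And>i. i \<le> k \<Longrightarrow> simple_path (e i)" "\<And>i. i \<le> k \<Longrightarrow> pathfinish (e i) = pathstart (e i)"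
    "\<And>i j. i \<le> k \<Longrightarrow> j \<le> k \<Longrightarrow> i \<noteq> j \<Longrightarrow> path_image (e i) \<inter> path_image (e j) = {}"
    "(\<Union>i\<le>k. path_image (e i)) = D - interior D"
proof -
  obtain c :: "nat \<Rightarrow> real^2" and r where cr: "\<And>i. i < k \<Longrightarrow> 0 < r i"
      "\<And>i. i < k \<Longrightarrow> cball (c i) (r i) \<subseteq> ball 0 1"
    and disj: "\<And>i j. i < k \<Longrightarrow> j < k \<Longrightarrow> i \<noteq> j \<Longrightarrow> disjnt (cball (c i) (r i)) (cball (c j) (r j))"
    and D: "D = cball 0 1 - (\<Union>i<k. ball (c i) (r i))"
    using assms unfolding disk_with_holes_def by blast
  \<comment> \<open>Index \<open>k\<close> stands for the outer circle.\<close>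
  define S where "S i = (if i < k then sphere (c i) (r i) else sphere 0 1)" for i
  have S_sub: "S i \<subseteq> cball (c i) (r i)" if "i < k" for i
    using that by (auto simp: S_def)
  have S_disj: "S i \<inter> S j = {}" if ij: "i \<le> k" "j \<le> k" "i \<noteq> j" for i j
  proof (cases "i < k \<and> j < k")
    case True
    then show ?thesis
      using S_sub[of i] S_sub[of j] disj[of i j] ij by (auto simp: disjnt_def)
  next
    case False
    then consider "i < k" "j = k" | "j < k" "i = k"
      using ij by linarith
    then show ?thesis
      using cr(2)[of i] cr(2)[of j] S_sub[of i] S_sub[of j]
      by cases (fastforce simp: S_def)+
  qed
  have "D - interior D \<subseteq> (\<Union>i\<le>k. S i)"
  proof -
    let ?U = "ball 0 1 - (\<Union>i<k. cball (c i) (r i))"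
    have "open ?U"
      by (intro open_Diff open_ball closed_UN) auto
    moreover have "?U \<subseteq> D"
      unfolding D using ball_subset_cball by fastforce
    ultimately have "?U \<subseteq> interior D"
      by (rule interior_maximal[rotated])
    moreover have "D \<subseteq> ?U \<union> (\<Union>i\<le>k. S i)"
    proof
      fix x assume x: "x \<in> D"
      show "x \<in> ?U \<union> (\<Union>i\<le>k. S i)"
      proof (cases "norm x = 1")
        case True
        then have "x \<in> S k" by (simp add: S_def)
        then show ?thesis by blast
      next
        case False
        then have "x \<in> ball 0 1" using x D by auto
        moreover have "x \<in> S i" if "i < k" "x \<in> cball (c i) (r i)" for i
          using that x D by (force simp: S_def)
        ultimately show ?thesis
          using less_imp_le by blast
      qed
    qed
    ultimately show ?thesis by blast
  qed
  moreover have "S i \<subseteq> D - interior D" if "i \<le> k" for i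
  proof (cases "i < k")
    case True
    have "S i \<subseteq> D"
    proof
      fix x assume x: "x \<in> S i"
      have "x \<notin> ball (c j) (r j)" if "j < k" for j
      proof (cases "j = i")
        case False
        then show ?thesis
          using disj[OF \<open>i < k\<close> \<open>j < k\<close>] x S_sub[OF True] ball_subset_cball
          by (fastforce simp: disjnt_def)
      qed (use x True in \<open>simp add: S_def\<close>)
      moreover have "x \<in> cball 0 1"
        using cr(2)[OF True] x S_sub[OF True] ball_subset_cball by blast
      ultimately show "x \<in> D"
        unfolding D by blast
    qed
    moreover have "interior D \<inter> ball (c i) (r i) = {}"
      using interior_subset[of D] True unfolding D by blast
    then have "interior D \<inter> closure (ball (c i) (r i)) = {}"
      by (simp add: open_Int_closure_eq_empty)
    then have "interior D \<inter> S i = {}"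
      using S_sub[OF True] cr(1)[OF True] by (auto simp: closure_ball)
    ultimately show ?thesis by blast
  next
    case False
    then have "S i = sphere 0 1" by (simp add: S_def)
    moreover have "sphere 0 1 \<inter> ball (c j) (r j) = {}" if "j < k" for j
      using cr(2)[OF that] ball_subset_cball by fastforce
    moreover have "interior D \<subseteq> ball 0 1"
      using interior_mono[of D "cball 0 1"] D by (simp add: interior_cball)
    ultimately show ?thesis
      unfolding D by (fastforce simp: D)
  qed
  ultimately have S: "(\<Union>i\<le>k. S i) = D - interior D"
    by blast
  have "\<exists>e. simple_path e \<and> pathfinish e = pathstart e \<and> path_image e = S i" for i
  proof -
    have "\<exists>a \<rho>. 0 < \<rho> \<and> S i = sphere a \<rho>"
    proof (cases "i < k")
      case True
      then show ?thesis
        using cr(1) by (auto simp: S_def)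
    next
      case False
      then show ?thesis
        by (intro exI[of _ 0] exI[of _ 1]) (simp add: S_def)
    qed
    then obtain a \<rho> where "0 < \<rho>" "S i = sphere a \<rho>"
      by blast
    moreover obtain e where "simple_path e" "pathfinish e = pathstart e" "path_image e = sphere a \<rho>"
      using \<open>0 < \<rho>\<close> by (rule circle_parametrization)
    ultimately show ?thesis
      by metis
  qed
  then obtain e where e: "\<And>i. simple_path (e i) \<and> pathfinish (e i) = pathstart (e i) \<and> path_image (e i) = S i"
    by metis
  show thesis
  proof (rule that[of e])
    show "(\<Union>i\<le>k. path_image (e i)) = D - interior D"
      using S by (simp only: e)
  qed (simp_all add: e S_disj)
qed

text \<open>Invariance of domain: a homeomorphism of subsets of the plane matches interior points, so
  the boundary circles of the model are carried to the boundary.\<close>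

lemma homeomorphic_disk_with_holes_boundary:
  fixes C :: "(real^2) set"
  assumes "disk_with_holes k D" "C homeomorphic D"
  obtains q :: "nat \<Rightarrow> real \<Rightarrow> real^2"
  where "\<And>i. i \<le> k \<Longrightarrow> simple_path (q i)" "\<And>i. i \<le> k \<Longrightarrow> pathfinish (q i) = pathstart (q i)"
    "\<And>i j. i \<le> k \<Longrightarrow> j \<le> k \<Longrightarrow> i \<noteq> j \<Longrightarrow> path_image (q i) \<inter> path_image (q j) = {}"
    "(\<Union>i\<le>k. path_image (q i)) = C - interior C"
proof -
  obtain h g where hg: "homeomorphism C D h g"
    using assms(2) by (auto simp: homeomorphic_def)
  then have cont: "continuous_on C h" "continuous_on D g" and im: "h ` C = D" "g ` D = C"
    and gh: "\<And>x. x \<in> C \<Longrightarrow> g (h x) = x" and hg': "\<And>y. y \<in> D \<Longrightarrow> h (g y) = y"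
    unfolding homeomorphism_def by blast+
  have inj: "inj_on h C" "inj_on g D"
    using gh hg' by (metis inj_on_inverseI)+
  have int: "h ` interior C \<subseteq> interior D" "g ` interior D \<subseteq> interior C"
    using continuous_image_subset_interior[OF cont(1) inj(1)]
      continuous_image_subset_interior[OF cont(2) inj(2)] im by auto
  have bd: "g ` (D - interior D) = C - interior C"
  proof
    show "g ` (D - interior D) \<subseteq> C - interior C"
    proof
      fix x assume "x \<in> g ` (D - interior D)"
      then obtain y where y: "y \<in> D" "y \<notin> interior D" "x = g y" by blast
      then have "x \<notin> interior C"
        using int(1) hg'[of y] by (metis image_subset_iff)
      then show "x \<in> C - interior C"
        using y im by blast
    qed
    show "C - interior C \<subseteq> g ` (D - interior D)"
    proof
      fix x assume x: "x \<in> C - interior C"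
      then have "h x \<notin> interior D"
        using int(2) gh[of x] by (metis DiffD1 DiffD2 image_subset_iff)
      then show "x \<in> g ` (D - interior D)"
        using x gh[of x] im by (metis DiffD1 DiffI imageI)
    qed
  qed
  obtain e where e: "\<And>i. i \<le> k \<Longrightarrow> simple_path (e i)"
      "\<And>i. i \<le> k \<Longrightarrow> pathfinish (e i) = pathstart (e i)"
      "\<And>i j. i \<le> k \<Longrightarrow> j \<le> k \<Longrightarrow> i \<noteq> j \<Longrightarrow> path_image (e i) \<inter> path_image (e j) = {}"
      "(\<Union>i\<le>k. path_image (e i)) = D - interior D"
    by (rule disk_with_holes_boundary[OF assms(1)]) blast
  have sub: "path_image (e i) \<subseteq> D" if "i \<le> k" for i
    using e(4) that by blast
  show thesis
  proof (rule that[of "\<lambda>i. g \<circ> e i"])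
    fix i assume i: "i \<le> k"
    show "simple_path (g \<circ> e i)"
      using e(1)[OF i] sub[OF i] cont(2) inj(2)
      by (intro simple_path_continuous_image) (auto intro: continuous_on_subset inj_on_subset)
    show "pathfinish (g \<circ> e i) = pathstart (g \<circ> e i)"
      using e(2)[OF i] by (simp add: pathfinish_compose pathstart_compose)
    fix j assume "j \<le> k" "i \<noteq> j"
    then have "g ` path_image (e i) \<inter> g ` path_image (e j) = {}"
      using e(3)[OF i] inj_on_image_Int[OF inj(2) sub[OF i] sub[of j]] by simp
    then show "path_image (g \<circ> e i) \<inter> path_image (g \<circ> e j) = {}"
      by (simp add: path_image_compose)
  next
    show "(\<Union>i\<le>k. path_image (g \<circ> e i)) = C - interior C"
      unfolding bd[symmetric] e(4)[symmetric] by (simp add: path_image_compose image_UN)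
  qed
qed

text \<open>The side of the curve away from \<open>\<Omega>\<close> is a connected open set that misses the closure of
  \<open>\<Omega>\<close>, and its frontier, being the curve, lies in that closure.\<close>

lemma far_side_component:
  fixes q :: "real \<Rightarrow> real^2"
  assumes q: "simple_path q" "pathfinish q = pathstart q"
    and "connected \<Omega>" "\<Omega> \<inter> path_image q = {}" "path_image q \<subseteq> closure \<Omega>"
  shows "\<exists>V\<in>components (- closure \<Omega>). frontier V = path_image q"
proof -
  obtain A B where A: "open A" "connected A" "A \<noteq> {}" and B: "open B" "connected B" "B \<noteq> {}"
    and AB: "A \<inter> B = {}" "A \<union> B = - path_image q"
    and fr: "frontier A = path_image q" "frontier B = path_image q"
    using Jordan_curve_plane[OF q] .
  have comp: "V \<in> components (- closure \<Omega>)"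
    if V: "open V" "connected V" "V \<noteq> {}" "V \<inter> \<Omega> = {}" "frontier V = path_image q" for V
    unfolding in_components_maximal
  proof (intro conjI allI impI)
    show "V \<subseteq> - closure \<Omega>"
      using V open_Int_closure_eq_empty by blast
    fix T assume T: "T \<noteq> {} \<and> V \<subseteq> T \<and> T \<subseteq> - closure \<Omega> \<and> connected T"
    then have "T \<inter> frontier V = {}"
      using assms(5) V by blast
    then have "T - V = {}"
      using connected_Int_frontier[of T V] T V by blast
    then show "T = V"
      using T by blast
  qed (use V in auto)
  have "\<Omega> \<subseteq> A \<union> B"
    using AB assms(4) by blast
  then have "A \<inter> \<Omega> = {} \<or> B \<inter> \<Omega> = {}"
    using connectedD[OF assms(3) A(1) B(1)] AB by blast
  then show ?thesis
    using comp[OF A _ fr(1)] comp[OF B _ fr(2)] fr by blast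
qed

text \<open>Of the \<open>k + 1\<close> far sides at most one is unbounded.\<close>

lemma many_interior_boundary_components:
  assumes "smooth_region_with_holes k \<Omega>"
  obtains I :: "nat set" and J where "finite I" "k \<le> card I"
    "\<And>i. i \<in> I \<Longrightarrow> J i \<in> interior_boundary_components \<Omega>"
    "\<And>i j. i \<in> I \<Longrightarrow> j \<in> I \<Longrightarrow> i \<noteq> j \<Longrightarrow> J i \<inter> J j = {}"
proof -
  obtain D where D: "disk_with_holes k D" "closure \<Omega> homeomorphic D"
    and "open \<Omega>" "connected \<Omega>"
    using assms unfolding smooth_region_with_holes_def by blast
  obtain q where q: "\<And>i. i \<le> k \<Longrightarrow> simple_path (q i)"
      "\<And>i. i \<le> k \<Longrightarrow> pathfinish (q i) = pathstart (q i)"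
      "\<And>i j. i \<le> k \<Longrightarrow> j \<le> k \<Longrightarrow> i \<noteq> j \<Longrightarrow> path_image (q i) \<inter> path_image (q j) = {}"
      "(\<Union>i\<le>k. path_image (q i)) = closure \<Omega> - interior (closure \<Omega>)"
    by (rule homeomorphic_disk_with_holes_boundary[OF D]) blast
  have "compact D"
    using D(1) unfolding disk_with_holes_def by (auto intro!: compact_diff open_UN)
  then have bdd: "bounded (- (- closure \<Omega>))"
    using homeomorphic_compactness[OF D(2)] by (simp add: compact_imp_bounded)
  have "\<Omega> \<subseteq> interior (closure \<Omega>)"
    using \<open>open \<Omega>\<close> closure_subset by (rule interior_maximal[rotated])
  then have sep: "\<Omega> \<inter> path_image (q i) = {}" "path_image (q i) \<subseteq> closure \<Omega>" if "i \<le> k" for i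
    using q(4) that by blast+
  have "\<exists>V\<in>components (- closure \<Omega>). frontier V = path_image (q i)" if "i \<le> k" for i
    using far_side_component[OF q(1,2)[OF that] \<open>connected \<Omega>\<close> sep[OF that]] .
  then obtain V where V: "\<And>i. i \<le> k \<Longrightarrow> V i \<in> components (- closure \<Omega>)"
      "\<And>i. i \<le> k \<Longrightarrow> frontier (V i) = path_image (q i)"
    by metis
  let ?I = "{i. i \<le> k \<and> bounded (V i)}"
  have "i = j" if "i \<le> k" "j \<le> k" "\<not> bounded (V i)" "\<not> bounded (V j)" for i j
  proof (rule ccontr)
    assume "i \<noteq> j"
    have "V j = V i"
      using cobounded_unique_unbounded_components[OF bdd V(1)[OF that(1)] that(3) V(1)[OF that(2)] that(4)]
      by simp
    then have "path_image (q i) = path_image (q j)"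
      using V(2)[OF that(1)] V(2)[OF that(2)] by simp
    then show False
      using q(3)[OF that(1,2) \<open>i \<noteq> j\<close>] path_image_nonempty[of "q j"] by simp
  qed
  then have "card {i. i \<le> k \<and> \<not> bounded (V i)} \<le> 1"
    by (auto simp: card_le_Suc0_iff_eq)
  moreover have "card ?I + card {i. i \<le> k \<and> \<not> bounded (V i)} = card {..k}"
  proof (subst card_Un_disjoint[symmetric])
    show "card (?I \<union> {i. i \<le> k \<and> \<not> bounded (V i)}) = card {..k}"
      by (rule arg_cong[where f=card]) auto
  qed auto
  ultimately have "k \<le> card ?I"
    by simp
  moreover have "path_image (q i) \<in> interior_boundary_components \<Omega>" if "i \<in> ?I" for i
    using V that unfolding interior_boundary_components_def holes_def
    by (metis (no_types, lifting) image_eqI mem_Collect_eq)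
  ultimately show thesis
    using q(3) by (intro that[of ?I "\<lambda>i. path_image (q i)"]) auto
qed

text \<open>A nonzero number of slits touches each interior boundary component. Choosing one end of one
  such slit for each component is injective on disjoint components, and there are only \<open>2 n\<close>
  ends.\<close>

lemma slit_lower_bound:
  assumes "smooth_region_with_holes k \<Omega>" "paths_slit \<Omega> n \<gamma>"
  shows "k \<le> 2 * n"
proof -
  obtain I :: "nat set" and J where I: "finite I" "k \<le> card I"
    "\<And>i. i \<in> I \<Longrightarrow> J i \<in> interior_boundary_components \<Omega>"
    "\<And>i j. i \<in> I \<Longrightarrow> j \<in> I \<Longrightarrow> i \<noteq> j \<Longrightarrow> J i \<inter> J j = {}"
    by (rule many_interior_boundary_components[OF assms(1)]) blast
  have "\<exists>p. p \<in> {1..n} \<times> {0, 1} \<and> \<gamma> (fst p) (snd p) \<in> J i" if "i \<in> I" for i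
  proof -
    let ?T = "{m\<in>{1..n}. pathstart (\<gamma> m) \<in> J i \<or> pathfinish (\<gamma> m) \<in> J i}"
    have "odd (card ?T)"
      using assms(2) I(3)[OF that] unfolding paths_slit_def by blast
    then have "?T \<noteq> {}"
      by (metis card.empty even_zero)
    then obtain m where "m \<in> {1..n}" "\<gamma> m 0 \<in> J i \<or> \<gamma> m 1 \<in> J i"
      unfolding pathstart_def pathfinish_def by blast
    then show ?thesis
      by (metis SigmaI fst_conv insertI1 insertI2 snd_conv)
  qed
  then obtain p where p: "\<And>i. i \<in> I \<Longrightarrow> p i \<in> {1..n} \<times> {0, 1::real} \<and> \<gamma> (fst (p i)) (snd (p i)) \<in> J i"
    by metis
  have "inj_on p I"
    using p I(4) by (intro inj_onI) (metis disjoint_iff)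
  moreover have "p ` I \<subseteq> {1..n} \<times> {0, 1}"
    using p by blast
  ultimately have "card I \<le> card ({1..n} \<times> {0, 1::real})"
    by (intro card_inj_on_le) auto
  then show ?thesis
    using I(2) by (simp add: card_cartesian_product)
qed

section \<open>Crosscuts\<close>

text \<open>The end points of the slits lie in the boundary, so two slits that meet in \<open>\<Omega>\<close> do so
  at inner parameters, where both have velocities from either side; such coincidences are isolated
  points of the parameter square.\<close>

lemma slit_coincidences_countable:
  assumes "open \<Omega>" "paths_slit \<Omega> n \<gamma>" "i \<in> {1..n}" "j \<in> {1..n}"
  shows "countable {(s, t). s \<in> {0..1} \<and> t \<in> {0..1} \<and> (i, s) \<noteq> (j, t) \<and> \<gamma> i s = \<gamma> j t \<and> \<gamma> i s \<in> \<Omega>}"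
    (is "countable ?E")
proof (rule isolated_points_countable)
  have ps: "piecewise_smooth (\<gamma> m)" and ends: "\<gamma> m 0 \<in> frontier \<Omega>" "\<gamma> m 1 \<in> frontier \<Omega>"
    if "m \<in> {1..n}" for m
    using assms(2) that
    unfolding paths_slit_def path_into_def joins_boundary_transversally_def by blast+
  have inner: "0 < s \<and> s < 1" if "m \<in> {1..n}" "s \<in> {0..1}" "\<gamma> m s \<in> \<Omega>" for m s
  proof -
    have "s \<noteq> 0" "s \<noteq> 1"
      using ends[OF that(1)] that(3) \<open>open \<Omega>\<close> by (auto simp: frontier_def interior_open)
    then show ?thesis
      using that(2) by auto
  qed
  have trans: "span {u, v} = UNIV"
    if "s \<in> {0..1}" "t \<in> {0..1}" "(i, s) \<noteq> (j, t)" "\<gamma> i s = \<gamma> j t" "\<gamma> i s \<in> \<Omega>"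
      "u \<in> velocities (\<gamma> i) s" "v \<in> velocities (\<gamma> j) t" for s t u v
    using assms that unfolding paths_slit_def internal_intersections_transversal_def by blast
  fix z assume "z \<in> ?E"
  then obtain s t where z: "z = (s, t)" and st: "s \<in> {0..1}" "t \<in> {0..1}" "(i, s) \<noteq> (j, t)"
    "\<gamma> i s = \<gamma> j t" "\<gamma> i s \<in> \<Omega>"
    by blast
  have "0 < s" "s < 1" "0 < t" "t < 1"
    using inner assms(3,4) st by auto
  then have "\<exists>e>0. \<forall>s'\<in>{0..1}. \<forall>t'\<in>{0..1}. \<bar>s' - s\<bar> < e \<longrightarrow> \<bar>t' - t\<bar> < e \<longrightarrow> \<gamma> i s' = \<gamma> j t' \<longrightarrow>
       s' = s \<and> t' = t"
    using ps assms(3,4) st(4) trans[OF st] by (intro transversal_isolated) auto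
  then obtain e where e: "0 < e" "\<forall>s'\<in>{0..1}. \<forall>t'\<in>{0..1}. \<bar>s' - s\<bar> < e \<longrightarrow> \<bar>t' - t\<bar> < e \<longrightarrow>
       \<gamma> i s' = \<gamma> j t' \<longrightarrow> s' = s \<and> t' = t"
    by blast
  let ?U = "{s - e<..<s + e} \<times> {t - e<..<t + e}"
  have "open ?U"
    by (intro open_Times) auto
  moreover have "?U \<inter> ?E = {z}"
  proof
    show "?U \<inter> ?E \<subseteq> {z}"
    proof
      fix y assume "y \<in> ?U \<inter> ?E"
      then obtain s' t' where y: "y = (s', t')" "s' \<in> {0..1}" "t' \<in> {0..1}" "\<gamma> i s' = \<gamma> j t'"
        "\<bar>s' - s\<bar> < e" "\<bar>t' - t\<bar> < e"
        by (auto simp: abs_less_iff)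
      then show "y \<in> {z}"
        using e(2) z by blast
    qed
    show "{z} \<subseteq> ?U \<inter> ?E"
      using z st e(1) by auto
  qed
  ultimately show "\<exists>U. open U \<and> U \<inter> ?E = {z}"
    by blast
qed

text \<open>A path that never entered \<open>\<Omega>\<close> would run in the boundary and start tangentially to it.\<close>

lemma slit_path_has_crosscut:
  assumes "open \<Omega>" "smooth_boundary \<Omega>" "paths_slit \<Omega> n \<gamma>" "i \<in> {1..n}"
  shows "\<exists>a b. 0 \<le> a \<and> a < b \<and> b \<le> 1 \<and> \<gamma> i a \<in> frontier \<Omega> \<and> \<gamma> i b \<in> frontier \<Omega> \<and>
    \<gamma> i ` {a<..<b} \<subseteq> \<Omega>"
proof -
  have ps: "piecewise_smooth (\<gamma> i)" and im: "path_image (\<gamma> i) \<subseteq> closure \<Omega>"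
    and ends: "\<gamma> i 0 \<in> frontier \<Omega>" "\<gamma> i 1 \<in> frontier \<Omega>"
    and transv: "\<And>v. v \<in> velocities (\<gamma> i) 0 \<Longrightarrow> \<not> tangent_vector (frontier \<Omega>) (\<gamma> i 0) v"
    using assms(3,4) unfolding paths_slit_def path_into_def joins_boundary_transversally_def
    by blast+
  have fr: "\<gamma> i t \<in> frontier \<Omega> \<or> \<gamma> i t \<in> \<Omega>" if "t \<in> {0..1}" for t
    using im that \<open>open \<Omega>\<close> by (auto simp: path_image_def frontier_def interior_open)
  obtain v where v: "(\<gamma> i has_vector_derivative v) (at 0 within {0..1})"
    using piecewise_smooth_right_velocity[OF ps order_refl zero_less_one] .
  then have "v \<in> velocities (\<gamma> i) 0"
    by (simp add: velocities_def)
  then have "\<not> (\<forall>t\<in>{0..1}. \<gamma> i t \<in> frontier \<Omega>)"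
    using tangent_vector_of_boundary_path[OF assms(1,2) _ v] transv by blast
  then obtain t where t: "t \<in> {0..1}" "\<gamma> i t \<notin> frontier \<Omega>"
    by blast
  obtain a b where ab: "0 \<le> a" "a < t" "t < b" "b \<le> 1" "\<gamma> i a \<in> frontier \<Omega>" "\<gamma> i b \<in> frontier \<Omega>"
    and out: "\<And>s. a < s \<Longrightarrow> s < b \<Longrightarrow> \<gamma> i s \<notin> frontier \<Omega>"
    by (rule excursion_from_closed_set[OF piecewise_smooth_imp_path[OF ps] frontier_closed ends t]) blast
  have "\<gamma> i ` {a<..<b} \<subseteq> \<Omega>"
  proof
    fix x assume "x \<in> \<gamma> i ` {a<..<b}"
    then obtain s where "a < s" "s < b" "x = \<gamma> i s" by auto
    then show "x \<in> \<Omega>"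
      using out[of s] fr[of s] ab by simp
  qed
  then show ?thesis
    using ab by (intro exI[of _ a] exI[of _ b]) simp
qed

text \<open>Each side of the curve accumulates at the given point of \<open>\<Omega>\<close>, so each side contains a
  nonempty open subset of \<open>\<Omega>\<close>, and the slits, being negligible, cannot cover it.\<close>

lemma no_Jordan_curve_in_slits:
  assumes "open \<Omega>" "paths_slit \<Omega> n \<gamma>"
    and c: "simple_path c" "pathfinish c = pathstart c"
      "path_image c \<subseteq> frontier \<Omega> \<union> (\<Union>i\<in>{1..n}. path_image (\<gamma> i))"
  shows "path_image c \<inter> \<Omega> = {}"
proof (rule ccontr)
  assume meets: "path_image c \<inter> \<Omega> \<noteq> {}"
  let ?N = "\<Union>i\<in>{1..n}. path_image (\<gamma> i)"
  have "negligible (path_image (\<gamma> i))" if "i \<in> {1..n}" for i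
    using assms(2) that unfolding paths_slit_def path_into_def
    by (intro negligible_piecewise_smooth_image) auto
  then have N: "negligible ?N"
    by (intro negligible_Union) auto
  have conn: "connected (\<Omega> - ?N)"
    using assms(2) unfolding paths_slit_def by blast
  obtain A B where A: "open A" "connected A" "A \<noteq> {}" and B: "open B" "connected B" "B \<noteq> {}"
    and AB: "A \<inter> B = {}" "A \<union> B = - path_image c"
    and fr: "frontier A = path_image c" "frontier B = path_image c"
    using Jordan_curve_plane[OF c(1,2)] .
  have side: "X \<inter> (\<Omega> - ?N) \<noteq> {}" if "open X" "frontier X = path_image c" for X
  proof -
    have "\<Omega> \<inter> closure X \<noteq> {}"
      using meets that by (auto simp: frontier_def)
    then have "X \<inter> \<Omega> \<noteq> {}"
      using open_Int_closure_eq_empty[OF assms(1)] by blast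
    then have "\<not> negligible (X \<inter> \<Omega>)"
      using that(1) assms(1) by (intro open_not_negligible) auto
    then have "\<not> X \<inter> \<Omega> \<subseteq> ?N"
      using N negligible_subset by blast
    then show ?thesis by blast
  qed
  have "\<Omega> \<inter> frontier \<Omega> = {}"
    using assms(1) by (auto simp: frontier_def interior_open)
  then have "\<Omega> - ?N \<subseteq> A \<union> B"
    using AB(2) c(3) by blast
  then show False
    using connectedD[OF conn A(1) B(1)] AB(1) side[OF A(1) fr(1)] side[OF B(1) fr(2)] by blast
qed


section \<open>The number of slits\<close>

text \<open>Every crosscut joins two different members of the current family: if both ends lay in one
  path-connected member, then that member and the crosscut would contain a Jordan curve through a point
  of \<open>\<Omega>\<close>. So each crosscut lowers by one the number of path-connected compact sets that are
  needed to cover the boundary and the crosscuts so far. The members may well intersect; only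
  their number matters.\<close>

lemma slit_upper_bound:
  assumes "smooth_region_with_holes k \<Omega>" "paths_slit \<Omega> n \<gamma>"
  shows "n \<le> k"
proof -
  obtain D where D: "disk_with_holes k D" "closure \<Omega> homeomorphic D"
    and \<Omega>: "open \<Omega>" "smooth_boundary \<Omega>"
    using assms(1) unfolding smooth_region_with_holes_def by blast
  obtain q :: "nat \<Rightarrow> real \<Rightarrow> real^2" where q: "\<And>i. i \<le> k \<Longrightarrow> simple_path (q i)"
      "(\<Union>i\<le>k. path_image (q i)) = closure \<Omega> - interior (closure \<Omega>)"
    by (rule homeomorphic_disk_with_holes_boundary[OF D]) blast
  have frontier: "(\<Union>i\<le>k. path_image (q i)) = frontier \<Omega>"
    using q(2) smooth_boundary_regular_open[OF \<Omega>] \<Omega>(1) by (simp add: frontier_def interior_open)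
  obtain a b where ab: "\<And>i. i \<in> {1..n} \<Longrightarrow> 0 \<le> a i \<and> a i < b i \<and> b i \<le> 1 \<and>
      \<gamma> i (a i) \<in> frontier \<Omega> \<and> \<gamma> i (b i) \<in> frontier \<Omega> \<and> \<gamma> i ` {a i<..<b i} \<subseteq> \<Omega>"
    using slit_path_has_crosscut[OF \<Omega> assms(2)] by metis
  have cont: "continuous_on {a i..b i} (\<gamma> i)" if "i \<in> {1..n}" for i
  proof -
    have "path (\<gamma> i)"
      using assms(2) that unfolding paths_slit_def path_into_def
      by (intro piecewise_smooth_imp_path) blast
    then show ?thesis
      unfolding path_def by (rule continuous_on_subset) (use ab[OF that] in auto)
  qed
  define K where "K j = frontier \<Omega> \<union> (\<Union>i\<in>{1..j}. \<gamma> i ` {a i..b i})" for j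
  have K_sub: "K j \<subseteq> frontier \<Omega> \<union> (\<Union>i\<in>{1..n}. path_image (\<gamma> i))" if "j \<le> n" for j
  proof -
    have "\<gamma> i ` {a i..b i} \<subseteq> path_image (\<gamma> i)" if "i \<in> {1..j}" for i
      using ab[of i] that \<open>j \<le> n\<close> unfolding path_image_def by (intro image_mono) auto
    then show ?thesis
      using that unfolding K_def by fastforce
  qed
  have distinct_ends: "\<not> (\<gamma> (Suc j) (a (Suc j)) \<in> L \<and> \<gamma> (Suc j) (b (Suc j)) \<in> L)"
    if j: "Suc j \<le> n" and L: "compact L" "path_connected L" "L \<subseteq> K j" for j L
  proof
    define m where "m = Suc j"
    assume "\<gamma> (Suc j) (a (Suc j)) \<in> L \<and> \<gamma> (Suc j) (b (Suc j)) \<in> L"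
    then have ends: "\<gamma> m (a m) \<in> L" "\<gamma> m (b m) \<in> L"
      by (simp_all add: m_def)
    have m: "m \<in> {1..n}" using j by (simp add: m_def)
    define E where "E i = {(s, t). s \<in> {0..1} \<and> t \<in> {0..1} \<and> (m, s) \<noteq> (i, t) \<and>
      \<gamma> m s = \<gamma> i t \<and> \<gamma> m s \<in> \<Omega>}" for i
    have E: "countable (fst ` E i)" if "i \<in> {1..n}" for i
      using slit_coincidences_countable[OF \<Omega>(1) assms(2) m that] unfolding E_def by simp
    have in\<Omega>: "\<gamma> m s \<in> \<Omega> \<and> s \<in> {0..1}" if "s \<in> {a m<..<b m}" for s
      using ab[OF m] that by auto
    have "{s\<in>{a m<..<b m}. \<gamma> m s \<in> L} \<subseteq> (\<Union>i\<in>{1..j}. fst ` E i)"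
    proof
      fix s assume s: "s \<in> {s\<in>{a m<..<b m}. \<gamma> m s \<in> L}"
      then have "\<gamma> m s \<in> K j" "\<gamma> m s \<notin> frontier \<Omega>"
        using L(3) in\<Omega>[of s] \<Omega>(1) by (auto simp: frontier_def interior_open)
      then obtain i t where i: "i \<in> {1..j}" and t: "t \<in> {a i..b i}" "\<gamma> m s = \<gamma> i t"
        unfolding K_def by blast
      have "t \<in> {0..1}"
        using ab[of i] i t j by auto
      moreover have "i \<noteq> m"
        using i by (simp add: m_def)
      ultimately have "(s, t) \<in> E i"
        using s t in\<Omega>[of s] unfolding E_def by simp
      then show "s \<in> (\<Union>i\<in>{1..j}. fst ` E i)"
        using i by force
    qed
    moreover have "countable (\<Union>i\<in>{1..j}. fst ` E i)"
      using E j by (intro countable_UN) auto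
    ultimately have cL: "countable {s\<in>{a m<..<b m}. \<gamma> m s \<in> L}"
      by (rule countable_subset)
    have "{s\<in>{a m<..<b m}. \<exists>t\<in>{a m..b m}. t \<noteq> s \<and> \<gamma> m t = \<gamma> m s} \<subseteq> fst ` E m"
    proof
      fix s assume "s \<in> {s\<in>{a m<..<b m}. \<exists>t\<in>{a m..b m}. t \<noteq> s \<and> \<gamma> m t = \<gamma> m s}"
      then obtain t where "s \<in> {a m<..<b m}" "t \<in> {a m..b m}" "t \<noteq> s" "\<gamma> m t = \<gamma> m s"
        by blast
      then have "(s, t) \<in> E m"
        using in\<Omega>[of s] ab[OF m] unfolding E_def by auto
      then show "s \<in> fst ` E m"
        by force
    qed
    then have c\<gamma>: "countable {s\<in>{a m<..<b m}. \<exists>t\<in>{a m..b m}. t \<noteq> s \<and> \<gamma> m t = \<gamma> m s}"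
      using E[OF m] countable_subset by blast
    have "a m < b m" using ab[OF m] by simp
    obtain c s where c: "simple_path c" "pathfinish c = pathstart c"
      "path_image c \<subseteq> L \<union> \<gamma> m ` {a m..b m}" "s \<in> {a m<..<b m}" "\<gamma> m s \<in> path_image c"
      using Jordan_curve_through_ear[OF L(1,2) \<open>a m < b m\<close> cont[OF m] ends cL c\<gamma>] .
    have "L \<union> \<gamma> m ` {a m..b m} \<subseteq> K m"
      using L(3) unfolding K_def m_def by fastforce
    then have "path_image c \<subseteq> frontier \<Omega> \<union> (\<Union>i\<in>{1..n}. path_image (\<gamma> i))"
      using c(3) K_sub[of m] m by fastforce
    then have "path_image c \<inter> \<Omega> = {}"
      by (rule no_Jordan_curve_in_slits[OF \<Omega>(1) assms(2) c(1,2)])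
    then show False
      using c(5) in\<Omega>[OF c(4)] by blast
  qed
  \<comment> \<open>The family starts with the \<open>k + 1\<close> boundary curves; a crosscut merges the two members that it
    joins.\<close>
  have "\<exists>\<G>. finite \<G> \<and> card \<G> + j \<le> Suc k \<and> \<Union>\<G> = K j \<and> (\<forall>L\<in>\<G>. compact L \<and> path_connected L)"
    if "j \<le> n" for j
    using that
  proof (induction j)
    case 0
    have "path (q i)" if "i \<le> k" for i
      using q(1)[OF that] by (rule simple_path_imp_path)
    moreover have "card ((\<lambda>i. path_image (q i)) ` {..k}) \<le> Suc k"
      using card_image_le[of "{..k}" "\<lambda>i. path_image (q i)"] by simp
    ultimately show ?case
      using frontier
      by (intro exI[of _ "(\<lambda>i. path_image (q i)) ` {..k}"])
        (auto simp: K_def compact_path_image path_connected_path_image)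
  next
    case (Suc j)
    then obtain \<G> where G: "finite \<G>" "card \<G> + j \<le> Suc k" "\<Union>\<G> = K j"
      "\<forall>L\<in>\<G>. compact L \<and> path_connected L"
      by auto
    define m where "m = Suc j"
    have m: "m \<in> {1..n}" using Suc.prems by (simp add: m_def)
    have "\<gamma> m (a m) \<in> K j" "\<gamma> m (b m) \<in> K j"
      using ab[OF m] by (auto simp: K_def)
    then obtain L L' where L: "L \<in> \<G>" "\<gamma> m (a m) \<in> L" and L': "L' \<in> \<G>" "\<gamma> m (b m) \<in> L'"
      using G(3) by blast
    have "L \<noteq> L'"
    proof
      assume "L = L'"
      moreover have "L \<subseteq> K j"
        using G(3) L(1) by blast
      ultimately show False
        using distinct_ends[OF Suc.prems, of L] G(4) L L' by (simp add: m_def)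
    qed
    define M where "M = L \<union> \<gamma> m ` {a m..b m} \<union> L'"
    have arc: "compact (\<gamma> m ` {a m..b m})" "path_connected (\<gamma> m ` {a m..b m})"
      using cont[OF m] by (auto intro!: compact_continuous_image path_connected_continuous_image)
    have "compact M"
      using arc G(4) L(1) L'(1) unfolding M_def by (intro compact_Un) auto
    moreover have "path_connected M"
    proof -
      have "\<gamma> m (a m) \<in> L \<inter> \<gamma> m ` {a m..b m}" "\<gamma> m (b m) \<in> (L \<union> \<gamma> m ` {a m..b m}) \<inter> L'"
        using L L' ab[OF m] by auto
      then show ?thesis
        using arc G(4) L(1) L'(1) unfolding M_def by (intro path_connected_Un) blast+
    qed
    moreover have "card (insert M (\<G> - {L, L'})) + m \<le> Suc k"
    proof -
      have "card (\<G> - {L, L'}) = card \<G> - 2"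
        using L(1) L'(1) \<open>L \<noteq> L'\<close> G(1) by (subst card_Diff_subset) auto
      moreover have "2 \<le> card \<G>"
        using card_mono[of \<G> "{L, L'}"] L(1) L'(1) \<open>L \<noteq> L'\<close> G(1) by simp
      moreover have "card (insert M (\<G> - {L, L'})) \<le> Suc (card (\<G> - {L, L'}))"
        by (rule card_insert_le_m1) simp_all
      ultimately show ?thesis
        using G(2) by (simp add: m_def)
    qed
    moreover have "\<Union>(insert M (\<G> - {L, L'})) = K m"
    proof -
      have "\<Union>(insert M (\<G> - {L, L'})) = \<Union>\<G> \<union> \<gamma> m ` {a m..b m}"
        using L(1) L'(1) unfolding M_def by blast
      also have "\<dots> = K m"
        unfolding G(3) K_def m_def by (simp add: atLeastAtMostSuc_conv Un_ac)
      finally show ?thesis .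
    qed
    ultimately show ?case
      using G(1,4) unfolding m_def[symmetric]
      by (intro exI[of _ "insert M (\<G> - {L, L'})"]) simp
  qed
  from this[OF order_refl] obtain \<G> where G: "finite \<G>" "card \<G> + n \<le> Suc k" "\<Union>\<G> = K n"
    by blast
  have "path_image (q 0) \<subseteq> K n"
    using frontier unfolding K_def by blast
  then have "\<G> \<noteq> {}"
    using G(3) path_image_nonempty[of "q 0"] by blast
  then have "0 < card \<G>"
    using G(1) by (simp add: card_gt_0_iff)
  then show ?thesis
    using G(2) by linarith
qed


theorem proposition5p1:
  fixes \<Omega> :: "(real^2) set"
    and k n :: nat
    and \<gamma> :: "nat \<Rightarrow> real \<Rightarrow> real^2"
  assumes "smooth_region_with_holes k \<Omega>"
    and "paths_slit \<Omega> n \<gamma>"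
  shows "real k / 2 \<le> real n \<and> n \<le> k"
  using slit_lower_bound[OF assms] slit_upper_bound[OF assms] by linarith

end
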